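(* Let $N$ be a finite ground set with $n=|N|$, let $f:2^N\to\mathbb{R}$ be monotone submodular with $f(\emptyset)=0$, and let $k$ be a positive integer and $m\geq 2$ an integer. Let $A$ be the output of the following algorithm (Algorithm 6 with input $m$). Initialize $A=\{a_1,a_2\}$. Phase 1: while $|A|<k$ and every minimizer of $A$ lies in $\{a_1,a_2\}$, set $l=\min\{m,k-|A|\}$ and set $A=A\cup S^*$, where $S^*$ maximizes, over all $S\subseteq N\setminus A$ with $|S|=l$, the quantity $$\min\{f(S\cup A\setminus\{a_1\}),\,f(S\cup A\setminus\{a_2\})\}-\min\{f(A\setminus\{a_1\}),\,f(A\setminus\{a_2\})\}.$$ Phase 2: while $|A|<k$, add to $A$ an element $x\in\arg\max_{x\in N\setminus A} f(x\mid A)$. Then there is an absolute constant $C>0$ such that $$g_1(A)\geq \Big(\beta\Big(0,\tfrac{k-2m-2}{k}\Big)-\tfrac{C}{m}\Big)\, g_1(OPT(k,N,1)),$$ (so the ratio tends to $(1-1/e)-O(1/m)$ as $k\to\infty$), and the algorithm makes $O(n^{m+1})$ value queries to $f$.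
   Context: For $A,X\subseteq N$, $f(X\mid A)=f(A\cup X)-f(A)$ and $f(x\mid A)=f(\{x\}\mid A)$. For a set $A$, $g_\tau(A)=\min_{Z\subseteq A,|Z|\leq \tau} f(A\setminus Z)$. The robust problem on instance $(k,N,\tau)$ is $\max_{A\subseteq N,|A|\leq k} g_\tau(A)$, and $OPT(k,N,\tau)$ denotes an optimal set for it. For $\tau=1$, an element $z\in A$ is a minimizer of $A$ if $f(A\setminus\{z\})=\min_{y\in A} f(A\setminus\{y\})$. The elements $a_1,a_2$ are the first two elements chosen by the greedy algorithm on $N$: $a_1\in\arg\max_{x\in N} f(\{x\})$ and $a_2\in\arg\max_{x\in N\setminus\{a_1\}} f(x\mid\{a_1\})$ (ties broken arbitrarily). For $\eta\in[0,1]$ and $\alpha\geq 0$, $\beta(\eta,\alpha)=\frac{e^\alpha-1}{e^\alpha-\eta}$. *)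

theory Defs
  imports Complex_Main "HOL-Library.FuncSet" "HOL-Library.Monad_Syntax"
begin

definition submodular_on :: "'a set \<Rightarrow> ('a set \<Rightarrow> real) \<Rightarrow> bool" where
  "submodular_on N f \<longleftrightarrow>
     (\<forall>A B. A \<subseteq> N \<longrightarrow> B \<subseteq> N \<longrightarrow> f (A \<union> B) + f (A \<inter> B) \<le> f A + f B)"

definition marginal :: "('a set \<Rightarrow> real) \<Rightarrow> 'a set \<Rightarrow> 'a set \<Rightarrow> real" where
  "marginal f X A = f (A \<union> X) - f A"

definition robust_value :: "('a set \<Rightarrow> real) \<Rightarrow> nat \<Rightarrow> 'a set \<Rightarrow> real" where
  "robust_value f \<tau> A = Min ((\<lambda>Z. f (A - Z)) ` {Z. Z \<subseteq> A \<and> card Z \<le> \<tau>})"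

definition is_OPT :: "('a set \<Rightarrow> real) \<Rightarrow> nat \<Rightarrow> 'a set \<Rightarrow> nat \<Rightarrow> 'a set \<Rightarrow> bool" where
  "is_OPT f k N \<tau> B \<longleftrightarrow> is_arg_max (robust_value f \<tau>) (\<lambda>A. A \<subseteq> N \<and> card A \<le> k) B"

definition minimizer :: "('a set \<Rightarrow> real) \<Rightarrow> 'a set \<Rightarrow> 'a \<Rightarrow> bool" where
  "minimizer f A z \<longleftrightarrow> z \<in> A \<and> f (A - {z}) = Min ((\<lambda>y. f (A - {y})) ` A)"

definition beta_ratio :: "real \<Rightarrow> real \<Rightarrow> real" where
  "beta_ratio \<eta> \<alpha> = (exp \<alpha> - 1) / (exp \<alpha> - \<eta>)"

text \<open>
  Value-oracle model. A computation maps the oracle to the set of its possible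
  (result, number of value queries) pairs; the set accounts for arbitrary
  tie-breaking, and is empty if some choice has no admissible candidate.
  A program built from the combinators below sees the oracle only through
  \<open>queries F\<close>, which pays for each set in \<open>F\<close> and returns the oracle restricted
  to \<open>F\<close>.
\<close>

type_synonym ('a, 'r) qcomp = "('a set \<Rightarrow> real) \<Rightarrow> ('r \<times> nat) set"

definition qreturn :: "'r \<Rightarrow> ('a, 'r) qcomp" where
  "qreturn x f = {(x, 0)}"

definition qchoose :: "'r set \<Rightarrow> ('a, 'r) qcomp" where
  "qchoose X f = X \<times> {0}"

definition queries :: "'a set set \<Rightarrow> ('a, 'a set \<Rightarrow> real) qcomp" where
  "queries F f = (if finite F then {(restrict f F, card F)} else {})"

definition qbind :: "('a, 'r) qcomp \<Rightarrow> ('r \<Rightarrow> ('a, 's) qcomp) \<Rightarrow> ('a, 's) qcomp" where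
  "qbind c h f = {(y, p + q) | x p y q. (x, p) \<in> c f \<and> (y, q) \<in> h x f}"

adhoc_overloading Monad_Syntax.bind \<rightleftharpoons> qbind

inductive qwhile_run ::
  "('s \<Rightarrow> ('a, bool) qcomp) \<Rightarrow> ('s \<Rightarrow> ('a, 's) qcomp) \<Rightarrow> ('a set \<Rightarrow> real) \<Rightarrow>
   's \<Rightarrow> 's \<Rightarrow> nat \<Rightarrow> bool"
  for test body f where
  stop: "(False, p) \<in> test s f \<Longrightarrow> qwhile_run test body f s s p"
| step: "(True, p) \<in> test s f \<Longrightarrow> (s', q) \<in> body s f \<Longrightarrow> qwhile_run test body f s' t r \<Longrightarrow>
         qwhile_run test body f s t (p + q + r)"

definition qwhile ::
  "('s \<Rightarrow> ('a, bool) qcomp) \<Rightarrow> ('s \<Rightarrow> ('a, 's) qcomp) \<Rightarrow> 's \<Rightarrow> ('a, 's) qcomp" where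
  "qwhile test body s f = {(t, q). qwhile_run test body f s t q}"

text \<open>
  In the programs below \<open>v\<close> is the table of queried values; it agrees with the
  oracle on every set at which it is evaluated.
\<close>

definition first_element :: "'a set \<Rightarrow> ('a, 'a) qcomp" where
  "first_element N = do {
     v \<leftarrow> queries {{x} | x. x \<in> N};
     qchoose {x. is_arg_max (\<lambda>x. v {x}) (\<lambda>x. x \<in> N) x}
   }"

definition greedy_element :: "'a set \<Rightarrow> 'a set \<Rightarrow> ('a, 'a) qcomp" where
  "greedy_element N A = do {
     v \<leftarrow> queries ({A} \<union> {A \<union> {x} | x. x \<in> N - A});
     qchoose {x. is_arg_max (\<lambda>x. marginal v {x} A) (\<lambda>x. x \<in> N - A) x}
   }"

definition phase1_test :: "nat \<Rightarrow> 'a \<Rightarrow> 'a \<Rightarrow> 'a set \<Rightarrow> ('a, bool) qcomp" where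
  "phase1_test k a1 a2 A =
     (if card A < k then do {
        v \<leftarrow> queries {A - {y} | y. y \<in> A};
        qreturn (\<forall>z. minimizer v A z \<longrightarrow> z \<in> {a1, a2})
      } else qreturn False)"

definition phase1_gain :: "('a set \<Rightarrow> real) \<Rightarrow> 'a \<Rightarrow> 'a \<Rightarrow> 'a set \<Rightarrow> 'a set \<Rightarrow> real" where
  "phase1_gain f a1 a2 A S =
     min (f (S \<union> A - {a1})) (f (S \<union> A - {a2})) - min (f (A - {a1})) (f (A - {a2}))"

definition phase1_body ::
  "'a set \<Rightarrow> nat \<Rightarrow> nat \<Rightarrow> 'a \<Rightarrow> 'a \<Rightarrow> 'a set \<Rightarrow> ('a, 'a set) qcomp" where
  "phase1_body N k m a1 a2 A =
     (let l = min m (k - card A);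
          cands = {S. S \<subseteq> N - A \<and> card S = l}
      in do {
        v \<leftarrow> queries ({A - {a} | a. a \<in> {a1, a2}} \<union>
                     {S \<union> A - {a} | S a. S \<in> cands \<and> a \<in> {a1, a2}});
        S \<leftarrow> qchoose {S. is_arg_max (phase1_gain v a1 a2 A) (\<lambda>S. S \<in> cands) S};
        qreturn (A \<union> S)
      })"

definition phase2_test :: "nat \<Rightarrow> 'a set \<Rightarrow> ('a, bool) qcomp" where
  "phase2_test k A = qreturn (card A < k)"

definition phase2_body :: "'a set \<Rightarrow> 'a set \<Rightarrow> ('a, 'a set) qcomp" where
  "phase2_body N A = do {
     x \<leftarrow> greedy_element N A;
     qreturn (A \<union> {x})
   }"

definition robust_algorithm :: "'a set \<Rightarrow> nat \<Rightarrow> nat \<Rightarrow> ('a, 'a set) qcomp" where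
  "robust_algorithm N k m = do {
     a1 \<leftarrow> first_element N;
     a2 \<leftarrow> greedy_element N {a1};
     A \<leftarrow> qwhile (phase1_test k a1 a2) (phase1_body N k m a1 a2) {a1, a2};
     qwhile (phase2_test k) (phase2_body N) A
   }"

text \<open>
  Non-vacuity: for \<open>2 \<le> |N|\<close> and \<open>k \<le> |N|\<close> the algorithm has at least one output.
\<close>

lemma ex_is_arg_max:
  fixes g :: "'b \<Rightarrow> real"
  assumes "finite X" "X \<noteq> {}"
  shows "\<exists>x. is_arg_max g (\<lambda>x. x \<in> X) x"
proof -
  have "Max (g ` X) \<in> g ` X" using assms by simp
  then obtain x where "x \<in> X" "g x = Max (g ` X)" by auto
  then show ?thesis using assms(1) by (auto simp: is_arg_max_linorder intro!: exI[of _ x])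
qed

lemma ex_greedy_element:
  assumes "finite N" "N - A \<noteq> {}"
  shows "\<exists>x q. x \<in> N - A \<and> (x, q) \<in> greedy_element N A f"
proof -
  let ?F = "{A} \<union> {A \<union> {x} | x. x \<in> N - A}"
  obtain x where x: "is_arg_max (\<lambda>x. marginal (restrict f ?F) {x} A) (\<lambda>x. x \<in> N - A) x"
    using ex_is_arg_max[of "N - A"] assms by blast
  moreover have "finite ?F" using assms(1) by simp
  moreover have "x \<in> N - A" using x by (simp add: is_arg_max_def)
  ultimately show ?thesis
    unfolding greedy_element_def qbind_def queries_def qchoose_def by force
qed

lemma robust_algorithm_has_output:
  assumes N: "finite N" "2 \<le> card N" "k \<le> card N" and m: "1 \<le> m"
  shows "robust_algorithm N k m f \<noteq> {}"
proof -
  have fin: "finite {S. S \<subseteq> N - A \<and> P S}" for A P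
    using finite_subset[of "{S. S \<subseteq> N - A \<and> P S}" "Pow N"] N(1) by auto
  have phase2: "\<exists>t q. qwhile_run (phase2_test k) (phase2_body N) f A t q" if "A \<subseteq> N" for A
    using that
  proof (induction "k - card A" arbitrary: A rule: less_induct)
    case less
    show ?case
    proof (cases "card A < k")
      case False
      then show ?thesis
        using qwhile_run.stop[of 0 "phase2_test k" A f "phase2_body N"]
        by (auto simp: phase2_test_def qreturn_def)
    next
      case True
      then have "N - A \<noteq> {}"
        using N less.prems by (metis Diff_eq_empty_iff leD subset_antisym)
      then obtain x q where x: "x \<in> N - A" "(x, q) \<in> greedy_element N A f"
        using ex_greedy_element[OF N(1)] by blast
      have "finite A" using less.prems N(1) finite_subset by blast
      then have "k - card (A \<union> {x}) < k - card A" using x(1) True by simp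
      then obtain t r where "qwhile_run (phase2_test k) (phase2_body N) f (A \<union> {x}) t r"
        using less.hyps[of "A \<union> {x}"] less.prems x(1) by blast
      moreover have "(A \<union> {x}, q) \<in> phase2_body N A f"
        using x(2) by (force simp: phase2_body_def qbind_def qreturn_def)
      moreover have "(True, 0) \<in> phase2_test k A f"
        using True by (simp add: phase2_test_def qreturn_def)
      ultimately show ?thesis by (blast intro: qwhile_run.step)
    qed
  qed
  have phase1: "\<exists>t q. t \<subseteq> N \<and>
      qwhile_run (phase1_test k a1 a2) (phase1_body N k m a1 a2) f A t q" if "A \<subseteq> N" for A a1 a2
    using that
  proof (induction "k - card A" arbitrary: A rule: less_induct)
    case less
    have finA: "finite A" using less.prems N(1) finite_subset by blast
    have "\<exists>b p. (b, p) \<in> phase1_test k a1 a2 A f"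
      using finA by (auto simp: phase1_test_def qbind_def qreturn_def queries_def)
    then obtain b p where b: "(b, p) \<in> phase1_test k a1 a2 A f" by blast
    show ?case
    proof (cases b)
      case False
      then show ?thesis using b less.prems by (metis qwhile_run.stop)
    next
      case True
      then have lt: "card A < k"
        using b by (auto simp: phase1_test_def qreturn_def split: if_splits)
      define l where "l = min m (k - card A)"
      define cands where "cands = {S. S \<subseteq> N - A \<and> card S = l}"
      let ?F = "{A - {a} | a. a \<in> {a1, a2}} \<union> {S \<union> A - {a} | S a. S \<in> cands \<and> a \<in> {a1, a2}}"
      have "l \<le> card (N - A)"
        using N finA less.prems by (simp add: l_def card_Diff_subset)
      then have ne: "cands \<noteq> {}"
        unfolding cands_def using obtain_subset_with_card_n by blast
      have finc: "finite cands" unfolding cands_def by (rule fin)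
      have finF: "finite ?F"
        using finc by (auto simp: setcompr_eq_image intro!: finite_image_set2 finite_image_set)
      obtain S where S: "is_arg_max (phase1_gain (restrict f ?F) a1 a2 A) (\<lambda>S. S \<in> cands) S"
        using ex_is_arg_max[OF finc ne] by blast
      then have Sc: "S \<subseteq> N - A" "card S = l" by (auto simp: is_arg_max_def cands_def)
      have body: "(A \<union> S, card ?F) \<in> phase1_body N k m a1 a2 A f"
        unfolding phase1_body_def Let_def l_def[symmetric] cands_def[symmetric]
          qbind_def queries_def qchoose_def qreturn_def
        using S finF by force
      have "finite S" using Sc(1) N(1) finite_subset by blast
      then have "card (A \<union> S) = card A + l"
        using finA Sc by (subst card_Un_disjoint) auto
      then have "k - card (A \<union> S) < k - card A" using lt m by (simp add: l_def)
      then obtain t r where t: "t \<subseteq> N"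
        "qwhile_run (phase1_test k a1 a2) (phase1_body N k m a1 a2) f (A \<union> S) t r"
        using less.hyps[of "A \<union> S"] less.prems Sc(1) by blast
      have "(True, p) \<in> phase1_test k a1 a2 A f" using b True by simp
      from qwhile_run.step[where body = "phase1_body N k m a1 a2", OF this body t(2)]
      show ?thesis using t(1) by (intro exI conjI)
    qed
  qed
  have "N \<noteq> {}" using N by auto
  then obtain a1 where a1: "is_arg_max (\<lambda>x. restrict f {{x} | x. x \<in> N} {x}) (\<lambda>x. x \<in> N) a1"
    using ex_is_arg_max[OF N(1)] by blast
  then have a1N: "a1 \<in> N" by (simp add: is_arg_max_def)
  have first: "(a1, card {{x} | x. x \<in> N}) \<in> first_element N f"
    unfolding first_element_def qbind_def queries_def qchoose_def
    using a1 N(1) by force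
  have "N - {a1} \<noteq> {}"
  proof
    assume "N - {a1} = {}"
    then have "N = {a1}" using a1N by blast
    then show False using N(2) by simp
  qed
  from ex_greedy_element[OF N(1) this, of f] obtain a2 q2
    where a2: "a2 \<in> N - {a1}" "(a2, q2) \<in> greedy_element N {a1} f" by (elim exE conjE)
  have "{a1, a2} \<subseteq> N" using a1N a2(1) by simp
  from phase1[OF this, of a1 a2] obtain A p where A: "A \<subseteq> N"
    "qwhile_run (phase1_test k a1 a2) (phase1_body N k m a1 a2) f {a1, a2} A p"
    by (elim exE conjE)
  obtain t r where t: "qwhile_run (phase2_test k) (phase2_body N) f A t r"
    using phase2[OF A(1)] by blast
  have bind_nonempty: "qbind c h f \<noteq> {}" if "(x, p) \<in> c f" "h x f \<noteq> {}"
    for c x p and h :: "_ \<Rightarrow> ('a, 'a set) qcomp"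
    using that by (fastforce simp: qbind_def)
  have w1: "(A, p) \<in> qwhile (phase1_test k a1 a2) (phase1_body N k m a1 a2) {a1, a2} f"
    and w2: "(t, r) \<in> qwhile (phase2_test k) (phase2_body N) A f"
    using A(2) t by (simp_all add: qwhile_def)
  show ?thesis
    unfolding robust_algorithm_def
    by (rule bind_nonempty, rule first, rule bind_nonempty, rule a2(2),
        rule bind_nonempty, rule w1) (use w2 in auto)
qed

end

theory Submission
  imports Defs
begin

text \<open>
  Let \<open>V\<close> be the optimal robust value, \<open>h A\<close> the smaller of \<open>f (A - {a1})\<close> and
  \<open>f (A - {a2})\<close>, and \<open>r = 1 - (m - 1) / k\<close>. Ordering \<open>Opt - A\<close> turns the marginals of
  \<open>f\<close> over \<open>A - {a1}\<close> and over \<open>A - {a2}\<close> into two additive weights, and a vertex of the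
  linear program with one cardinality and one weight constraint has at most two fractional
  coordinates, so some \<open>m\<close> elements capture a fraction \<open>(m - 1) / k\<close> of both weights. Hence
  every iteration of phase 1 contracts \<open>V - h A\<close> by \<open>r\<close>.

  If phase 1 ends early, let \<open>D\<close> bound the loss caused by removing one element from the
  final set. Such a \<open>D\<close> is attained by an element outside \<open>{a1, a2}\<close>, so \<open>h \<ge> 2 * D\<close> already
  after the first iteration, and the greedy phase starts from a set of value at least \<open>D\<close>
  above its robust value. With \<open>Q\<close> the total contraction and \<open>q\<close> the contraction of
  phase 2, the result is at least \<open>(1 - Q) * V + (q + 2 * Q - 1) * D\<close>, and the second term is
  nonnegative because \<open>q\<close> and the bound used for \<open>Q\<close> are at least \<open>1 / e \<ge> 1 / 3\<close>.
\<close>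


section \<open>Balanced subsets for two weight functions\<close>

text \<open>Move \<open>x\<close> along \<open>d\<close> until the first coordinate reaches 0 or 1.
  That coordinate leaves the fractional set, and none enters it because \<open>d\<close> vanishes on
  the integral coordinates.\<close>

lemma push_to_boundary:
  fixes x d :: "'a \<Rightarrow> real"
  assumes fin: "finite X" and x: "\<And>j. j \<in> X \<Longrightarrow> 0 \<le> x j \<and> x j \<le> 1"
    and d0: "\<And>j. j \<in> X \<Longrightarrow> \<not> (0 < x j \<and> x j < 1) \<Longrightarrow> d j = 0"
    and nz: "a \<in> X" "d a \<noteq> 0"
  obtains t where "t \<ge> 0" "\<And>j. j \<in> X \<Longrightarrow> 0 \<le> x j + t * d j \<and> x j + t * d j \<le> 1"
    "{j \<in> X. 0 < x j + t * d j \<and> x j + t * d j < 1} \<subset> {j \<in> X. 0 < x j \<and> x j < 1}"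
proof -
  define J where "J = {j \<in> X. d j \<noteq> 0}"
  \<comment> \<open>The step length at which coordinate \<open>j\<close> leaves the unit interval:
    at 1 if it grows, at 0 if it shrinks.\<close>
  define \<tau> where "\<tau> j = (if d j > 0 then (1 - x j) / d j else x j / (- d j))" for j
  define t where "t = Min (\<tau> ` J)"
  have J: "finite J" "J \<noteq> {}" "J \<subseteq> X" using fin nz by (auto simp: J_def)
  have "t \<in> \<tau> ` J" unfolding t_def using J by (intro Min_in) auto
  then obtain b where b: "b \<in> J" "t = \<tau> b" by auto
  have le: "t \<le> \<tau> j" if "j \<in> J" for j unfolding t_def using J that by simp
  have t0: "t \<ge> 0" unfolding b \<tau>_def
    using x[of b] b J by (auto simp: J_def divide_nonneg_pos divide_nonneg_neg)
  have bounds: "0 \<le> x j + t * d j \<and> x j + t * d j \<le> 1" if j: "j \<in> X" for j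
  proof (cases "d j = 0")
    case True
    then show ?thesis using x[OF j] by simp
  next
    case False
    then have tj: "t \<le> \<tau> j" using le j by (simp add: J_def)
    show ?thesis
    proof (cases "d j > 0")
      case True
      then have "t * d j \<le> 1 - x j" using tj by (simp add: \<tau>_def pos_le_divide_eq)
      moreover have "0 \<le> t * d j" using t0 True by simp
      ultimately show ?thesis using x[OF j] by linarith
    next
      case neg: False
      then have "0 < - d j" using False by simp
      then have "t * (- d j) \<le> x j"
        using tj neg pos_le_divide_eq[of "- d j" t "x j"] unfolding \<tau>_def by simp
      moreover have "t * d j \<le> 0" using t0 neg by (simp add: mult_nonneg_nonpos)
      ultimately show ?thesis using x[OF j] by simp
    qed
  qed
  have frac: "0 < x j \<and> x j < 1" if "j \<in> X" "0 < x j + t * d j \<and> x j + t * d j < 1" for j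
  proof (rule ccontr)
    assume "\<not> (0 < x j \<and> x j < 1)"
    moreover from this have "d j = 0" using d0 that(1) by blast
    ultimately show False using that(2) by simp
  qed
  have "x b + t * d b = 0 \<or> x b + t * d b = 1"
    using b(1) unfolding b(2) by (auto simp: \<tau>_def J_def)
  then have "b \<notin> {j \<in> X. 0 < x j + t * d j \<and> x j + t * d j < 1}" by auto
  moreover have "b \<in> {j \<in> X. 0 < x j \<and> x j < 1}" using d0[of b] b(1) by (auto simp: J_def)
  moreover have "{j \<in> X. 0 < x j + t * d j \<and> x j + t * d j < 1} \<subseteq> {j \<in> X. 0 < x j \<and> x j < 1}"
    using frac by blast
  ultimately have "{j \<in> X. 0 < x j + t * d j \<and> x j + t * d j < 1} \<subset> {j \<in> X. 0 < x j \<and> x j < 1}"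
    by blast
  then show ?thesis using that t0 bounds by blast
qed

text \<open>Three fractional coordinates leave a nonzero direction that keeps both the total and the
  \<open>w1\<close>-sum, since these are two linear equations in three unknowns. Oriented so that
  the \<open>w2\<close>-sum does not drop, it is followed to the boundary of the cube; induction is
  on the number of fractional coordinates.\<close>

lemma fractional_rounding:
  fixes x w1 w2 :: "'a \<Rightarrow> real"
  assumes fin: "finite X" and x: "\<And>j. j \<in> X \<Longrightarrow> 0 \<le> x j \<and> x j \<le> 1"
  shows "\<exists>y. (\<forall>j\<in>X. 0 \<le> y j \<and> y j \<le> 1) \<and> (\<Sum>j\<in>X. y j) = (\<Sum>j\<in>X. x j) \<and>
    (\<Sum>j\<in>X. w1 j * y j) = (\<Sum>j\<in>X. w1 j * x j) \<and>
    (\<Sum>j\<in>X. w2 j * y j) \<ge> (\<Sum>j\<in>X. w2 j * x j) \<and>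
    card {j \<in> X. 0 < y j \<and> y j < 1} \<le> 2"
  using x
proof (induction "card {j \<in> X. 0 < x j \<and> x j < 1}" arbitrary: x rule: less_induct)
  case less
  let ?F = "{j \<in> X. 0 < x j \<and> x j < 1}"
  show ?case
  proof (cases "card ?F \<le> 2")
    case True
    then show ?thesis using less.prems by (intro exI[of _ x]) auto
  next
    case False
    then have "3 \<le> card ?F" by simp
    then obtain G where "G \<subseteq> ?F" "card G = 3" by (meson obtain_subset_with_card_n)
    then obtain a b c where abc: "a \<in> ?F" "b \<in> ?F" "c \<in> ?F" "a \<noteq> b" "b \<noteq> c" "a \<noteq> c"
      by (auto simp: card_3_iff)
    \<comment> \<open>Outside the degenerate case this is, up to sign, the cross product of
      \<open>(1, 1, 1)\<close> with \<open>(w1 a, w1 b, w1 c)\<close>. If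
      \<open>w1 a = w1 b\<close>, exchanging mass between \<open>a\<close> and \<open>b\<close>
      suffices and is certainly nonzero.\<close>
    define d0 where "d0 j =
      (if w1 a = w1 b then (if j = a then 1 else if j = b then - 1 else 0)
       else if j = a then w1 b - w1 c else if j = b then w1 c - w1 a
       else if j = c then w1 a - w1 b else 0)" for j
    define \<sigma> :: real where "\<sigma> = (if (\<Sum>j\<in>X. w2 j * d0 j) \<ge> 0 then 1 else - 1)"
    define d where "d j = \<sigma> * d0 j" for j
    have \<sigma>: "\<sigma> \<noteq> 0" by (simp add: \<sigma>_def)
    have sum_d: "(\<Sum>j\<in>X. g j * d j) = \<sigma> * (\<Sum>j\<in>X. g j * d0 j)" for g :: "'a \<Rightarrow> real"
      by (simp add: d_def sum_distrib_left mult_ac)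
    have sum3: "(\<Sum>j\<in>X. g j * d0 j) = g a * d0 a + g b * d0 b + g c * d0 c" for g :: "'a \<Rightarrow> real"
    proof -
      have "(\<Sum>j\<in>X. g j * d0 j) = (\<Sum>j\<in>{a, b, c}. g j * d0 j)"
        using fin abc by (intro sum.mono_neutral_right) (auto simp: d0_def)
      then show ?thesis using abc by simp
    qed
    have "(\<Sum>j\<in>X. 1 * d0 j) = 0"
      unfolding sum3 using abc by (auto simp: d0_def)
    then have s0: "(\<Sum>j\<in>X. d j) = 0" using sum_d[of "\<lambda>_. 1"] by simp
    have "(\<Sum>j\<in>X. w1 j * d0 j) = 0"
      unfolding sum3 using abc by (auto simp: d0_def algebra_simps)
    then have s1: "(\<Sum>j\<in>X. w1 j * d j) = 0" by (simp add: sum_d)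
    have s2: "(\<Sum>j\<in>X. w2 j * d j) \<ge> 0" unfolding sum_d by (simp add: \<sigma>_def)
    have nz: "\<exists>j\<in>X. d j \<noteq> 0"
    proof (cases "w1 a = w1 b")
      case True
      then show ?thesis using abc by (intro bexI[of _ a]) (auto simp: d_def d0_def \<sigma>)
    next
      case False
      then show ?thesis using abc by (intro bexI[of _ c]) (auto simp: d_def d0_def \<sigma>)
    qed
    have out: "d j = 0" if "\<not> (0 < x j \<and> x j < 1)" for j
      using that abc by (auto simp: d_def d0_def \<sigma>)
    from nz obtain e where "e \<in> X" "d e \<noteq> 0" by blast
    then obtain t where t: "t \<ge> 0" "\<And>j. j \<in> X \<Longrightarrow> 0 \<le> x j + t * d j \<and> x j + t * d j \<le> 1"
      "{j \<in> X. 0 < x j + t * d j \<and> x j + t * d j < 1} \<subset> ?F"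
      using push_to_boundary[of X x d e] fin less.prems out by blast
    have lt: "card {j \<in> X. 0 < x j + t * d j \<and> x j + t * d j < 1} < card ?F"
      using t(3) fin by (intro psubset_card_mono) auto
    have lin: "(\<Sum>j\<in>X. g j * (x j + t * d j)) = (\<Sum>j\<in>X. g j * x j) + t * (\<Sum>j\<in>X. g j * d j)"
      for g :: "'a \<Rightarrow> real"
      by (simp add: distrib_left sum.distrib sum_distrib_left mult_ac)
    have e0: "(\<Sum>j\<in>X. x j + t * d j) = (\<Sum>j\<in>X. x j)" using lin[of "\<lambda>_. 1"] s0 by simp
    have e1: "(\<Sum>j\<in>X. w1 j * (x j + t * d j)) = (\<Sum>j\<in>X. w1 j * x j)" using lin[of w1] s1 by simp
    have e2: "(\<Sum>j\<in>X. w2 j * (x j + t * d j)) \<ge> (\<Sum>j\<in>X. w2 j * x j)"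
      using lin[of w2] s2 t(1) by simp
    show ?thesis
      using less.hyps[OF lt t(2)] e2 unfolding e0 e1 by (meson order_trans)
  qed
qed

text \<open>Round the constant vector \<open>(m - 1) / k\<close>, whose total is at most
  \<open>m - 1\<close>, and take the support of the result. Rounding the remaining fractions up only
  increases nonnegative weights.\<close>

lemma balanced_subset:
  fixes w1 w2 :: "'a \<Rightarrow> real"
  assumes fin: "finite X" and card: "card X \<le> k" and m: "1 \<le> m" "m \<le> k"
    and w1: "\<And>j. j \<in> X \<Longrightarrow> 0 \<le> w1 j" and w2: "\<And>j. j \<in> X \<Longrightarrow> 0 \<le> w2 j"
  obtains S where "S \<subseteq> X" "card S \<le> m"
    "(real m - 1) / real k * sum w1 X \<le> sum w1 S" "(real m - 1) / real k * sum w2 X \<le> sum w2 S"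
proof -
  let ?c = "(real m - 1) / real k"
  have c: "0 \<le> ?c" "?c \<le> 1" using m by (auto simp: divide_le_eq_1)
  obtain y where y: "\<And>j. j \<in> X \<Longrightarrow> 0 \<le> y j \<and> y j \<le> 1" "(\<Sum>j\<in>X. y j) = (\<Sum>j\<in>X. ?c)"
    "(\<Sum>j\<in>X. w1 j * y j) = (\<Sum>j\<in>X. w1 j * ?c)" "(\<Sum>j\<in>X. w2 j * y j) \<ge> (\<Sum>j\<in>X. w2 j * ?c)"
    "card {j \<in> X. 0 < y j \<and> y j < 1} \<le> 2"
    using fractional_rounding[OF fin, of "\<lambda>_. ?c" w1 w2] c by blast
  define P where "P = {j \<in> X. y j = 1}"
  define F where "F = {j \<in> X. 0 < y j \<and> y j < 1}"
  have PF: "finite P" "finite F" "P \<inter> F = {}" "P \<union> F \<subseteq> X" using fin by (auto simp: P_def F_def)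
  have restr: "(\<Sum>j\<in>X. g j * y j) = (\<Sum>j\<in>P \<union> F. g j * y j)" for g :: "'a \<Rightarrow> real"
    using fin y(1) by (intro sum.mono_neutral_right) (force simp: P_def F_def)+
  have "real (card X) * ?c \<le> real m - 1"
  proof -
    have "real (card X) / real k \<le> 1" using card m by (simp add: divide_le_eq_1)
    then have "real (card X) / real k * (real m - 1) \<le> 1 * (real m - 1)"
      using m by (intro mult_right_mono) auto
    then show ?thesis by simp
  qed
  then have "(\<Sum>j\<in>P. y j) + (\<Sum>j\<in>F. y j) \<le> real m - 1"
    using restr[of "\<lambda>_. 1"] y(2) PF by (simp add: sum.union_disjoint)
  moreover have "(\<Sum>j\<in>P. y j) = real (card P)" by (simp add: P_def)
  ultimately have PFm: "real (card P) + (\<Sum>j\<in>F. y j) \<le> real m - 1" by simp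
  have "card (P \<union> F) \<le> m"
  proof (cases "F = {}")
    case True
    then show ?thesis using PFm by simp
  next
    case False
    \<comment> \<open>Positive fractional mass forces \<open>card P < m - 1\<close>, which leaves
      room for the two fractional elements. This is where one unit of the budget \<open>m\<close> is
      spent.\<close>
    then have "0 < (\<Sum>j\<in>F. y j)" using PF by (intro sum_pos) (auto simp: F_def)
    then have "card P + 1 < m" using PFm by linarith
    moreover have "card F \<le> 2" using y(5) by (simp add: F_def)
    ultimately show ?thesis using PF by (simp add: card_Un_disjoint)
  qed
  moreover have le: "(\<Sum>j\<in>X. g j * y j) \<le> sum g (P \<union> F)" if "\<And>j. j \<in> X \<Longrightarrow> 0 \<le> g j" for g :: "'a \<Rightarrow> real"
    unfolding restr using PF y(1) that by (intro sum_mono) (auto intro!: mult_left_le)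
  have "(\<Sum>j\<in>X. w1 j * ?c) \<le> sum w1 (P \<union> F)" "(\<Sum>j\<in>X. w2 j * ?c) \<le> sum w2 (P \<union> F)"
    using le[of w1] le[of w2] w1 w2 y(3,4) by auto
  then have "?c * sum w1 X \<le> sum w1 (P \<union> F)" "?c * sum w2 X \<le> sum w2 (P \<union> F)"
    by (simp_all add: sum_distrib_right[symmetric] mult.commute sum_divide_distrib[symmetric])
  ultimately show ?thesis using that PF(4) by blast
qed

section \<open>Monotone submodular functions\<close>

locale monotone_submodular =
  fixes N :: "'a set" and f :: "'a set \<Rightarrow> real"
  assumes finite_ground: "finite N" and mono_f: "mono_on (Pow N) f"
    and submodular_f: "submodular_on N f" and f_empty: "f {} = 0"
begin

lemma finite_sub: "A \<subseteq> N \<Longrightarrow> finite A"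
  using finite_ground finite_subset by blast

lemma f_mono: "A \<subseteq> B \<Longrightarrow> B \<subseteq> N \<Longrightarrow> f A \<le> f B"
  using mono_f by (auto simp: mono_on_def)

lemma f_nonneg: "A \<subseteq> N \<Longrightarrow> 0 \<le> f A"
  using f_mono[of "{}" A] f_empty by simp

lemma marginal_antimono:
  assumes "A \<subseteq> B" "B \<subseteq> N" "X \<subseteq> N"
  shows "marginal f X B \<le> marginal f X A"
proof -
  have "f ((A \<union> X) \<union> B) + f ((A \<union> X) \<inter> B) \<le> f (A \<union> X) + f B"
    using submodular_f[unfolded submodular_on_def, rule_format, of "A \<union> X" B] assms by simp
  moreover have "(A \<union> X) \<union> B = B \<union> X" using assms by blast
  moreover have "f A \<le> f ((A \<union> X) \<inter> B)" using assms by (intro f_mono) auto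
  ultimately show ?thesis by (simp add: marginal_def)
qed

lemma marginal_le_sum:
  assumes "A \<subseteq> N" "X \<subseteq> N"
  shows "marginal f X A \<le> (\<Sum>x\<in>X. marginal f {x} A)"
proof -
  have "finite X" using assms(2) by (rule finite_sub)
  then show ?thesis using assms(2)
  proof (induction X rule: finite_induct)
    case empty
    then show ?case by (simp add: marginal_def)
  next
    case (insert x X)
    have "marginal f {x} (A \<union> X) \<le> marginal f {x} A"
      using assms insert by (intro marginal_antimono) auto
    moreover have "marginal f (insert x X) A = marginal f X A + marginal f {x} (A \<union> X)"
      by (simp add: marginal_def)
    ultimately show ?case using insert by simp
  qed
qed

text \<open>The weights are the increments of \<open>f\<close> as the elements of \<open>X\<close>
  are added to \<open>A\<close> one at a time. They telescope over \<open>X\<close>; within a subset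
  \<open>S\<close> each element is added to a smaller set, so by diminishing returns it gains at
  least its weight.\<close>

lemma chain_weights:
  assumes A: "A \<subseteq> N" and X: "X \<subseteq> N"
  shows "\<exists>w. (\<forall>x\<in>X. 0 \<le> w x) \<and> sum w X = marginal f X A \<and> (\<forall>S\<subseteq>X. sum w S \<le> marginal f S A)"
proof -
  have "finite X" using X by (rule finite_sub)
  then show ?thesis using X
  proof (induction X rule: finite_induct)
    case empty
    then show ?case by (auto simp: marginal_def)
  next
    case (insert x X)
    then obtain w where w: "\<forall>x\<in>X. 0 \<le> w x" "sum w X = marginal f X A"
      "\<forall>S\<subseteq>X. sum w S \<le> marginal f S A" by auto
    define v where "v = w(x := marginal f {x} (A \<union> X))"
    have vw: "sum v S = sum w S" if "S \<subseteq> X" for S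
      using insert.hyps that by (intro sum.cong) (auto simp: v_def)
    have "0 \<le> v x" unfolding v_def marginal_def using A insert.prems by (auto intro!: f_mono)
    then have "\<forall>y\<in>insert x X. 0 \<le> v y" using w(1) by (auto simp: v_def)
    moreover have "sum v (insert x X) = marginal f (insert x X) A"
      using insert.hyps vw[of X] w(2) by (simp add: v_def marginal_def)
    moreover have "sum v S \<le> marginal f S A" if S: "S \<subseteq> insert x X" for S
    proof (cases "x \<in> S")
      case False
      then have "S \<subseteq> X" using S by blast
      then show ?thesis using vw w(3) by simp
    next
      case True
      let ?T = "S - {x}"
      have T: "?T \<subseteq> X" using S by blast
      have "finite ?T" using T insert.hyps finite_subset by blast
      then have "sum v S = v x + sum v ?T"
        using True sum.remove[of S x v] by (simp add: finite_Diff2)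
      moreover have "v x \<le> marginal f {x} (A \<union> ?T)"
        unfolding v_def fun_upd_same using A insert.prems T by (intro marginal_antimono) auto
      moreover have "sum v ?T \<le> marginal f ?T A" using vw[OF T] w(3) T by simp
      moreover have "A \<union> ?T \<union> {x} = A \<union> S" using True by blast
      ultimately show ?thesis by (simp add: marginal_def)
    qed
    ultimately show ?case by (intro exI[of _ v]) blast
  qed
qed

section \<open>Robust value under the removal of one element\<close>

lemma robust_value_finite:
  assumes "A \<subseteq> N"
  shows "finite ((\<lambda>Z. f (A - Z)) ` {Z. Z \<subseteq> A \<and> card Z \<le> 1})"
  using finite_sub[OF assms] by (auto intro!: finite_imageI finite_subset[of _ "Pow A"])

text \<open>For \<open>y\<close> outside \<open>A\<close> the bound comes from removing nothing.
  This case is needed for \<open>Opt - {a1}\<close> and \<open>Opt - {a2}\<close>.\<close>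

lemma robust_value_le:
  assumes "A \<subseteq> N"
  shows "robust_value f 1 A \<le> f (A - {y})"
proof -
  let ?Z = "if y \<in> A then {y} else {}"
  have "?Z \<in> {Z. Z \<subseteq> A \<and> card Z \<le> 1}" by auto
  then have "f (A - ?Z) \<in> (\<lambda>Z. f (A - Z)) ` {Z. Z \<subseteq> A \<and> card Z \<le> 1}" by (rule imageI)
  then have "robust_value f 1 A \<le> f (A - ?Z)"
    unfolding robust_value_def using robust_value_finite[OF assms] by (intro Min_le)
  moreover have "A - {y} = A - ?Z" by auto
  ultimately show ?thesis by simp
qed

text \<open>By monotonicity, removing nothing is never worse than removing some element of the
  nonempty set \<open>A\<close>, so single removals decide the minimum.\<close>

lemma robust_value_ge:
  assumes A: "A \<subseteq> N" "A \<noteq> {}" and c: "\<And>y. y \<in> A \<Longrightarrow> c \<le> f (A - {y})"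
  shows "c \<le> robust_value f 1 A"
proof -
  have "c \<le> f (A - Z)" if Z: "Z \<subseteq> A" "card Z \<le> 1" for Z
  proof (cases "Z = {}")
    case True
    obtain y where y: "y \<in> A" using A by blast
    have "f (A - {y}) \<le> f A" using A by (intro f_mono) auto
    then show ?thesis using True c[OF y] by simp
  next
    case False
    have "finite Z" using Z A finite_sub finite_subset by blast
    then have "card Z = 1" using False Z(2) by (simp add: le_Suc_eq)
    then obtain y where "Z = {y}" by (auto simp: card_1_singleton_iff)
    then show ?thesis using c Z by auto
  qed
  moreover have "{} \<in> {Z. Z \<subseteq> A \<and> card Z \<le> 1}" by simp
  ultimately show ?thesis
    unfolding robust_value_def using robust_value_finite[OF A(1)] by (intro Min.boundedI) auto
qed

lemma robust_value_nonneg: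
  assumes "A \<subseteq> N"
  shows "0 \<le> robust_value f 1 A"
proof -
  have "0 \<le> f (A - Z)" for Z using assms by (intro f_nonneg) blast
  moreover have "{} \<in> {Z. Z \<subseteq> A \<and> card Z \<le> 1}" by simp
  ultimately show ?thesis
    unfolding robust_value_def using robust_value_finite[OF assms] by (intro Min.boundedI) auto
qed

lemma robust_value_mono:
  assumes "A \<subseteq> B" "B \<subseteq> N" "B \<noteq> {}"
  shows "robust_value f 1 A \<le> robust_value f 1 B"
proof (rule robust_value_ge[OF assms(2,3)])
  fix y
  have "robust_value f 1 A \<le> f (A - {y})" using assms by (intro robust_value_le) auto
  also have "\<dots> \<le> f (B - {y})" using assms by (intro f_mono) auto
  finally show "robust_value f 1 A \<le> f (B - {y})" .
qed

lemma minimizer_robust_value: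
  assumes A: "A \<subseteq> N" and z: "minimizer f A z"
  shows "robust_value f 1 A = f (A - {z})"
proof (rule antisym[OF robust_value_le[OF A] robust_value_ge[OF A]])
  show "A \<noteq> {}" using z by (auto simp: minimizer_def)
  show "f (A - {z}) \<le> f (A - {y})" if "y \<in> A" for y
    using z that finite_sub[OF A] by (simp add: minimizer_def)
qed

lemma ex_minimizer:
  assumes "A \<subseteq> N" "A \<noteq> {}"
  obtains z where "minimizer f A z"
proof -
  have "Min ((\<lambda>y. f (A - {y})) ` A) \<in> (\<lambda>y. f (A - {y})) ` A"
    using finite_sub assms by (intro Min_in) auto
  then show ?thesis using that by (auto simp: minimizer_def)
qed

end


section \<open>Semantics of the programs\<close>

lemma qwhile_run_invariant:
  assumes "qwhile_run test body f s t q" "I s"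
    and "\<And>s s' p q. I s \<Longrightarrow> (True, p) \<in> test s f \<Longrightarrow> (s', q) \<in> body s f \<Longrightarrow> I s'"
  shows "I t \<and> (\<exists>p. (False, p) \<in> test t f)"
  using assms(1,2) by (induction rule: qwhile_run.induct) (use assms(3) in blast)+

text \<open>The potential \<open>\<mu>\<close> grows by at least one per iteration, so its total
  increase bounds the number of iterations. The extra 1 pays for the final failing test.\<close>

lemma qwhile_run_cost:
  fixes \<mu> :: "'s \<Rightarrow> nat"
  assumes "qwhile_run test body f s t q" "I s"
    and test: "\<And>s x p. I s \<Longrightarrow> (x, p) \<in> test s f \<Longrightarrow> p \<le> a"
    and body: "\<And>s s' p q. I s \<Longrightarrow> (True, p) \<in> test s f \<Longrightarrow> (s', q) \<in> body s f \<Longrightarrow>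
      I s' \<and> \<mu> s < \<mu> s' \<and> q \<le> b"
  shows "\<mu> s \<le> \<mu> t \<and> q \<le> (\<mu> t - \<mu> s + 1) * (a + b)"
  using assms(1,2)
proof (induction rule: qwhile_run.induct)
  case (stop p s)
  then show ?case using test[of s False p] by simp
next
  case (step p s s' q t r)
  have s': "I s'" "\<mu> s < \<mu> s'" "q \<le> b" using body[OF step.prems step.hyps(1,2)] by auto
  have p: "p \<le> a" using test[OF step.prems step.hyps(1)] .
  have IH: "\<mu> s' \<le> \<mu> t" "r \<le> (\<mu> t - \<mu> s' + 1) * (a + b)" using step.IH[OF s'(1)] by auto
  have "(\<mu> t - \<mu> s' + 1) * (a + b) \<le> (\<mu> t - \<mu> s) * (a + b)"
    using s'(2) IH(1) by (intro mult_right_mono) auto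
  then have "p + q + r \<le> (a + b) + (\<mu> t - \<mu> s) * (a + b)" using p s'(3) IH(2) by linarith
  then show ?case using s'(2) IH(1) by simp
qed

lemma first_elementD:
  assumes fin: "finite N" and run: "(x, q) \<in> first_element N f"
  shows "x \<in> N" "\<And>y. y \<in> N \<Longrightarrow> f {y} \<le> f {x}" "q \<le> card N"
proof -
  let ?F = "{{x} | x. x \<in> N}"
  have F: "?F = (\<lambda>x. {x}) ` N" by auto
  have q: "q = card ?F" and x: "is_arg_max (\<lambda>x. restrict f ?F {x}) (\<lambda>x. x \<in> N) x"
    using run fin by (auto simp: first_element_def qbind_def queries_def qchoose_def)
  show "x \<in> N" using x by (simp add: is_arg_max_def)
  show "f {y} \<le> f {x}" if "y \<in> N" for y
    using x that by (auto simp: is_arg_max_linorder)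
  show "q \<le> card N" unfolding q F using fin by (rule card_image_le)
qed

text \<open>Every set at which the table is evaluated belongs to the queried family, so maximizing
  over the restricted table is maximizing over \<open>f\<close> itself.\<close>

lemma greedy_elementD:
  assumes fin: "finite N" and run: "(x, q) \<in> greedy_element N A f"
  shows "x \<in> N - A" "\<And>y. y \<in> N - A \<Longrightarrow> marginal f {y} A \<le> marginal f {x} A" "q \<le> card N + 1"
proof -
  let ?F = "{A} \<union> {A \<union> {x} | x. x \<in> N - A}"
  have F: "?F = insert A ((\<lambda>x. A \<union> {x}) ` (N - A))" by auto
  have q: "q = card ?F"
    and x: "is_arg_max (\<lambda>x. marginal (restrict f ?F) {x} A) (\<lambda>x. x \<in> N - A) x"
    using run fin by (auto simp: greedy_element_def qbind_def queries_def qchoose_def)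
  have r: "marginal (restrict f ?F) {y} A = marginal f {y} A" if "y \<in> N - A" for y
  proof -
    have "A \<union> {y} \<in> ?F" "A \<in> ?F" using that by blast+
    then show ?thesis by (simp add: marginal_def)
  qed
  show xN: "x \<in> N - A" using x by (simp add: is_arg_max_def)
  show "marginal f {y} A \<le> marginal f {x} A" if "y \<in> N - A" for y
    using x[unfolded is_arg_max_linorder, THEN conjunct2, rule_format, OF that]
    unfolding r[OF that] r[OF xN] .
  have "card ?F \<le> Suc (card ((\<lambda>x. A \<union> {x}) ` (N - A)))"
    unfolding F using fin by (simp add: card_insert_if)
  also have "card ((\<lambda>x. A \<union> {x}) ` (N - A)) \<le> card (N - A)"
    using fin by (intro card_image_le) auto
  also have "card (N - A) \<le> card N" using fin by (intro card_mono) auto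
  finally show "q \<le> card N + 1" unfolding q by simp
qed

lemma phase1_testD:
  assumes fin: "finite A" and run: "(b, q) \<in> phase1_test k a1 a2 A f"
  shows "b \<longleftrightarrow> card A < k \<and> (\<forall>z. minimizer f A z \<longrightarrow> z \<in> {a1, a2})" "q \<le> card A"
proof -
  let ?F = "{A - {y} | y. y \<in> A}"
  have F: "?F = (\<lambda>y. A - {y}) ` A" by auto
  have r: "restrict f ?F (A - {y}) = f (A - {y})" if "y \<in> A" for y
    using that by (intro restrict_apply') blast
  have img: "(\<lambda>y. restrict f ?F (A - {y})) ` A = (\<lambda>y. f (A - {y})) ` A"
    by (intro image_cong r refl)
  have min_eq: "minimizer (restrict f ?F) A z = minimizer f A z" for z
    unfolding minimizer_def img by (rule conj_cong[OF refl]) (simp only: r)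
  have finF: "finite ?F" unfolding F using fin by simp
  have "card A < k \<Longrightarrow> b \<longleftrightarrow> (\<forall>z. minimizer (restrict f ?F) A z \<longrightarrow> z \<in> {a1, a2})"
    and "\<not> card A < k \<Longrightarrow> \<not> b"
    using run finF unfolding phase1_test_def qbind_def queries_def qreturn_def by auto
  then show "b \<longleftrightarrow> card A < k \<and> (\<forall>z. minimizer f A z \<longrightarrow> z \<in> {a1, a2})"
    unfolding min_eq by blast
  have "card ?F \<le> card A" unfolding F using fin by (rule card_image_le)
  then show "q \<le> card A"
    using run fin by (auto simp: phase1_test_def qbind_def queries_def qreturn_def split: if_splits)
qed

text \<open>\<open>phase1_gain\<close> of \<open>S\<close> is this value at
  \<open>A \<union> S\<close> minus a term independent of \<open>S\<close>, so phase 1 maximizes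
  \<open>pair_value\<close>.\<close>

definition pair_value :: "('a set \<Rightarrow> real) \<Rightarrow> 'a \<Rightarrow> 'a \<Rightarrow> 'a set \<Rightarrow> real" where
  "pair_value f a1 a2 A = min (f (A - {a1})) (f (A - {a2}))"

lemma phase1_bodyD:
  assumes fin: "finite N" and N: "1 \<le> card N" and run: "(B, q) \<in> phase1_body N k m a1 a2 A f"
  obtains S where "B = A \<union> S" "S \<subseteq> N - A" "card S = min m (k - card A)"
    "\<And>T. T \<subseteq> N - A \<Longrightarrow> card T = min m (k - card A) \<Longrightarrow>
       pair_value f a1 a2 (A \<union> T) \<le> pair_value f a1 a2 (A \<union> S)"
    "q \<le> 2 + 2 * card N ^ m"
proof -
  define l where "l = min m (k - card A)"
  define cands where "cands = {S. S \<subseteq> N - A \<and> card S = l}"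
  let ?F = "{A - {a} | a. a \<in> {a1, a2}} \<union> {S \<union> A - {a} | S a. S \<in> cands \<and> a \<in> {a1, a2}}"
  have finc: "finite cands" unfolding cands_def
    using finite_subset[of "{S. S \<subseteq> N - A \<and> card S = l}" "Pow N"] fin by auto
  have F: "?F = (\<lambda>a. A - {a}) ` {a1, a2} \<union> (\<lambda>(S, a). S \<union> A - {a}) ` (cands \<times> {a1, a2})" by auto
  have finF: "finite ?F" unfolding F using finc by simp
  obtain S where B: "B = A \<union> S" and q: "q = card ?F"
    and S: "is_arg_max (phase1_gain (restrict f ?F) a1 a2 A) (\<lambda>S. S \<in> cands) S"
    using run finF
    unfolding phase1_body_def Let_def l_def[symmetric] cands_def[symmetric]
      qbind_def queries_def qchoose_def qreturn_def by auto
  have Sc: "S \<in> cands" using S by (simp add: is_arg_max_def)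
  have r: "phase1_gain (restrict f ?F) a1 a2 A T = pair_value f a1 a2 (A \<union> T) - pair_value f a1 a2 A"
    if "T \<in> cands" for T
  proof -
    have "A - {a1} \<in> ?F" "A - {a2} \<in> ?F" "T \<union> A - {a1} \<in> ?F" "T \<union> A - {a2} \<in> ?F"
      using that by blast+
    then show ?thesis by (simp add: phase1_gain_def pair_value_def Un_commute)
  qed
  have max: "pair_value f a1 a2 (A \<union> T) \<le> pair_value f a1 a2 (A \<union> S)" if "T \<in> cands" for T
    using S[unfolded is_arg_max_linorder, THEN conjunct2, rule_format, OF that]
    unfolding r[OF that] r[OF Sc] by simp
  \<comment> \<open>There are \<open>card (N - A)\<close> choose \<open>l\<close> candidates, hence
    at most \<open>card N ^ m\<close>; each is queried with \<open>a1\<close> and with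
    \<open>a2\<close> removed.\<close>
  have "l \<le> card (N - A)" using Sc fin by (auto simp: cands_def intro!: card_mono)
  then have "card cands \<le> card (N - A) ^ l"
    unfolding cands_def using fin by (simp add: n_subsets binomial_le_pow)
  also have "\<dots> \<le> card N ^ l" using fin by (intro power_mono card_mono) auto
  also have "\<dots> \<le> card N ^ m" using N by (intro power_increasing) (auto simp: l_def)
  finally have cc: "card cands \<le> card N ^ m" .
  have two: "card {a1, a2} \<le> 2" by (simp add: card_insert_if)
  have "card ?F \<le> card ((\<lambda>a. A - {a}) ` {a1, a2}) + card ((\<lambda>(S, a). S \<union> A - {a}) ` (cands \<times> {a1, a2}))"
    unfolding F by (rule card_Un_le)
  also have "\<dots> \<le> card {a1, a2} + card (cands \<times> {a1, a2})"
    using finc by (intro add_mono card_image_le) auto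
  also have "\<dots> \<le> 2 + card N ^ m * 2"
    unfolding card_cartesian_product using two cc by (intro add_mono mult_mono) auto
  finally have "q \<le> 2 + 2 * card N ^ m" unfolding q by simp
  then show ?thesis
    using that[of S] B Sc max unfolding cands_def l_def by blast
qed

lemma phase2_bodyD:
  assumes fin: "finite N" and run: "(B, q) \<in> phase2_body N A f"
  obtains x where "B = A \<union> {x}" "x \<in> N - A"
    "\<And>y. y \<in> N - A \<Longrightarrow> marginal f {y} A \<le> marginal f {x} A" "q \<le> card N + 1"
proof -
  obtain x where B: "B = A \<union> {x}" and x: "(x, q) \<in> greedy_element N A f"
    using run by (auto simp: phase2_body_def qbind_def qreturn_def)
  from greedy_elementD[OF fin x] show ?thesis using that[OF B] by blast
qed

lemma phase2_testD:
  assumes "(b, q) \<in> phase2_test k A f"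
  shows "b \<longleftrightarrow> card A < k" "q = 0"
  using assms by (auto simp: phase2_test_def qreturn_def)

lemma robust_algorithmD:
  assumes "(A, q) \<in> robust_algorithm N k m f"
  obtains a1 a2 B q1 q2 q3 q4 where
    "(a1, q1) \<in> first_element N f" "(a2, q2) \<in> greedy_element N {a1} f"
    "qwhile_run (phase1_test k a1 a2) (phase1_body N k m a1 a2) f {a1, a2} B q3"
    "qwhile_run (phase2_test k) (phase2_body N) f B A q4"
    "q = q1 + (q2 + (q3 + q4))"
  using assms that
  by (auto simp: robust_algorithm_def qbind_def qwhile_def)

section \<open>Counting value queries\<close>

lemma robust_algorithm_subset_and_cost:
  assumes fin: "finite N" and m: "m \<ge> 2" and run: "(A, q) \<in> robust_algorithm N k m f"
  shows "A \<subseteq> N" and "q \<le> 8 * card N ^ (m + 1)"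
proof -
  obtain a1 a2 B q1 q2 q3 q4 where
    r1: "(a1, q1) \<in> first_element N f" and r2: "(a2, q2) \<in> greedy_element N {a1} f" and
    r3: "qwhile_run (phase1_test k a1 a2) (phase1_body N k m a1 a2) f {a1, a2} B q3" and
    r4: "qwhile_run (phase2_test k) (phase2_body N) f B A q4" and
    q: "q = q1 + (q2 + (q3 + q4))"
    by (rule robust_algorithmD[OF run])
  let ?n = "card N"
  have a1: "a1 \<in> N" "q1 \<le> ?n" using first_elementD(1,3)[OF fin r1] by auto
  have a2: "a2 \<in> N - {a1}" "q2 \<le> ?n + 1" using greedy_elementD(1,3)[OF fin r2] by auto
  have sub: "{a1, a2} \<subseteq> N" using a1 a2 by auto
  have "card {a1, a2} \<le> ?n" using sub fin by (intro card_mono) auto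
  then have n: "2 \<le> ?n" using a2 by auto
  have fs: "finite s" if "s \<subseteq> N" for s using that fin finite_subset by blast
  have card_le: "card s \<le> ?n" if "s \<subseteq> N" for s using that fin by (rule card_mono[rotated])
  have step1: "s' \<subseteq> N \<and> card s < card s' \<and> q \<le> 2 + 2 * ?n ^ m"
    if s: "s \<subseteq> N" and t: "(True, p) \<in> phase1_test k a1 a2 s f"
      and b: "(s', q) \<in> phase1_body N k m a1 a2 s f" for s s' p q
  proof -
    have lt: "card s < k" using phase1_testD(1)[OF fs t] s by simp
    have "1 \<le> ?n" using n by simp
    from phase1_bodyD[OF fin this b] obtain S where S: "s' = s \<union> S" "S \<subseteq> N - s"
      "card S = min m (k - card s)" "q \<le> 2 + 2 * ?n ^ m" by metis
    have "0 < card S" using S(3) lt m by simp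
    moreover have "card s' = card s + card S"
      unfolding S(1) using S(2) s fs by (intro card_Un_disjoint) auto
    ultimately show ?thesis using S s by auto
  qed
  have inv1: "B \<subseteq> N"
    using qwhile_run_invariant[OF r3, of "\<lambda>s. s \<subseteq> N"] sub step1 by blast
  have cost1: "card {a1, a2} \<le> card B \<and> q3 \<le> (card B - card {a1, a2} + 1) * (?n + (2 + 2 * ?n ^ m))"
  proof (rule qwhile_run_cost[where I = "\<lambda>s. s \<subseteq> N", OF r3])
    show "{a1, a2} \<subseteq> N" using sub by simp
    show "p \<le> ?n" if s: "s \<subseteq> N" and t: "(x, p) \<in> phase1_test k a1 a2 s f" for s x p
      using phase1_testD(2)[OF fs t] card_le[of s] s by simp
  qed (rule step1)
  have step2: "s' \<subseteq> N \<and> card s < card s' \<and> q \<le> ?n + 1"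
    if s: "s \<subseteq> N" and b: "(s', q) \<in> phase2_body N s f" for s s' q
  proof -
    from phase2_bodyD[OF fin b] obtain x where "s' = s \<union> {x}" "x \<in> N - s" "q \<le> ?n + 1" by metis
    then show ?thesis using s fs by auto
  qed
  have inv2: "A \<subseteq> N"
    using qwhile_run_invariant[OF r4, of "\<lambda>s. s \<subseteq> N"] inv1 step2 by blast
  have cost2: "card B \<le> card A \<and> q4 \<le> (card A - card B + 1) * (0 + (?n + 1))"
  proof (rule qwhile_run_cost[where I = "\<lambda>s. s \<subseteq> N", OF r4 inv1])
    show "p \<le> 0" if "(x, p) \<in> phase2_test k s f" for s x p using phase2_testD[OF that] by simp
  qed (use step2 in blast)
  have c2: "card {a1, a2} = 2" using a2 by auto
  \<comment> \<open>The potential is the cardinality. Starting from two elements, iterations plus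
    the final test number at most \<open>card N\<close>.\<close>
  have "card B - card {a1, a2} + 1 \<le> ?n" using cost1 card_le[of B] inv1 n c2 by linarith
  then have q3: "q3 \<le> ?n * (?n + (2 + 2 * ?n ^ m))"
    using cost1 by (meson le_trans mult_le_mono1)
  have "2 \<le> card B" using cost1 c2 by simp
  then have "card A - card B + 1 \<le> ?n" using cost2 card_le[of A] inv2 n by linarith
  then have q4: "q4 \<le> ?n * (?n + 1)"
    using cost2 by (metis add_0 le_trans mult_le_mono1)
  \<comment> \<open>The costs add up to at most
    \<open>2 * ?n ^ (m + 1) + 2 * ?n * ?n + 5 * ?n + 1\<close>; since \<open>?n\<close> is at least
    2, the lower terms fit under the factor 8.\<close>
  have "2 * ?n \<le> ?n * ?n" using n by simp
  moreover have "?n * ?n \<le> ?n ^ (m + 1)"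
    using power_increasing[of 2 "m + 1" ?n] m n by (simp add: power2_eq_square)
  moreover have "?n * (?n + (2 + 2 * ?n ^ m)) = ?n * ?n + 2 * ?n + 2 * ?n ^ (m + 1)"
    by (simp add: algebra_simps)
  moreover have "?n * (?n + 1) = ?n * ?n + ?n" by simp
  ultimately show "q \<le> 8 * ?n ^ (m + 1)"
    using q a1(2) a2(2) q3 q4 n by linarith
  show "A \<subseteq> N" by (rule inv2)
qed


section \<open>Quality of the output\<close>

locale greedy_pair = monotone_submodular +
  fixes a1 a2 :: 'a
  assumes a1: "a1 \<in> N" "\<And>x. x \<in> N \<Longrightarrow> f {x} \<le> f {a1}"
    and a2: "a2 \<in> N - {a1}" "\<And>x. x \<in> N - {a1} \<Longrightarrow> marginal f {x} {a1} \<le> marginal f {a2} {a1}"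
begin

abbreviation h :: "'a set \<Rightarrow> real" where
  "h \<equiv> pair_value f a1 a2"

text \<open>Marginals are taken over both single elements because deleting one of \<open>a1\<close>,
  \<open>a2\<close> leaves the other.\<close>

definition third_element_gain :: "real \<Rightarrow> bool" where
  "third_element_gain D \<longleftrightarrow>
     (\<exists>w\<in>N - {a1, a2}. D \<le> marginal f {w} {a1} \<and> D \<le> marginal f {w} {a2})"

text \<open>By diminishing returns, an element whose removal from a large set costs \<open>D\<close>
  gains at least \<open>D\<close> over each of \<open>a1\<close> and \<open>a2\<close>
  alone.\<close>

lemma third_element_gainI:
  assumes "{a1, a2} \<subseteq> A" "A \<subseteq> N" "w \<in> A" "w \<notin> {a1, a2}"
  shows "third_element_gain (f A - f (A - {w}))"
proof -
  have "A - {w} \<union> {w} = A" using assms by blast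
  then have "f A - f (A - {w}) = marginal f {w} (A - {w})" by (simp add: marginal_def)
  moreover have "marginal f {w} (A - {w}) \<le> marginal f {w} {a1}"
    "marginal f {w} (A - {w}) \<le> marginal f {w} {a2}"
    using assms by (intro marginal_antimono; auto)+
  ultimately show ?thesis unfolding third_element_gain_def using assms by (intro bexI[of _ w]) auto
qed

text \<open>The witness \<open>w\<close> was available when \<open>a2\<close> was chosen, so
  \<open>a2\<close> gains at least \<open>D\<close> over \<open>a1\<close>; hence
  \<open>f {a2}\<close>, and with it the best singleton \<open>f {a1}\<close>, is at least
  \<open>D\<close>.\<close>

lemma third_element_gain_le:
  assumes "third_element_gain D"
  shows "2 * D \<le> f {a1, a2}" "D \<le> f {a2}" "D \<le> f {a1}"
proof -
  obtain w where w: "w \<in> N - {a1, a2}" "D \<le> marginal f {w} {a1}"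
    using assms by (auto simp: third_element_gain_def)
  have D: "D \<le> marginal f {a2} {a1}" using a2(2)[of w] w by auto
  also have "\<dots> \<le> marginal f {a2} {}" using a1 a2 by (intro marginal_antimono) auto
  also have "\<dots> = f {a2}" by (simp add: marginal_def f_empty)
  finally show D2: "D \<le> f {a2}" .
  then show D1: "D \<le> f {a1}" using a1(2)[of a2] a2(1) by auto
  have "f {a1, a2} = f {a1} + marginal f {a2} {a1}" by (simp add: marginal_def insert_commute)
  then show "2 * D \<le> f {a1, a2}" using D D1 by simp
qed

text \<open>Whichever of \<open>a1\<close>, \<open>a2\<close> is deleted, the other remains together
  with \<open>w\<close>, and the two are worth at least \<open>D + D\<close>.\<close>

lemma h_first_step:
  assumes w: "w \<in> N - {a1, a2}" "D \<le> marginal f {w} {a1}" "D \<le> marginal f {w} {a2}"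
    and T: "w \<in> T" "T \<subseteq> N"
  shows "2 * D \<le> h ({a1, a2} \<union> T)"
proof -
  have "third_element_gain D" using w by (auto simp: third_element_gain_def)
  note D = third_element_gain_le[OF this]
  have "2 * D \<le> f {a1, w}" "2 * D \<le> f {a2, w}"
    using w(2,3) D by (simp_all add: marginal_def insert_commute)
  moreover have "f {a2, w} \<le> f ({a1, a2} \<union> T - {a1})" "f {a1, w} \<le> f ({a1, a2} \<union> T - {a2})"
    using w(1) T a1 a2 by (intro f_mono; auto)+
  ultimately show ?thesis by (simp add: pair_value_def)
qed

end

section \<open>Progress of the two phases towards the optimum\<close>

locale robust_comparison = greedy_pair +
  fixes Opt :: "'a set" and k m :: nat
  assumes Opt: "Opt \<subseteq> N" "card Opt \<le> k" and m: "2 \<le> m" and k: "2 * m + 2 \<le> k"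
begin

abbreviation V :: real where
  "V \<equiv> robust_value f 1 Opt"

abbreviation r :: real where
  "r \<equiv> 1 - (real m - 1) / real k"

lemma r_bounds: "0 \<le> r" "r \<le> 1"
  using m k by (auto simp: divide_le_eq_1)

lemma V_nonneg: "0 \<le> V"
  using Opt(1) by (rule robust_value_nonneg)

text \<open>\<open>balanced_subset\<close> is applied to the chain weights of \<open>Opt - A\<close>
  over \<open>A - {a1}\<close> and over \<open>A - {a2}\<close>, so one set serves both
  deletions.\<close>

lemma ex_contracting_set:
  assumes A: "{a1, a2} \<subseteq> A" "A \<subseteq> N" and room: "m \<le> card (N - A)"
  obtains T where "T \<subseteq> N - A" "card T = m" "V - h (A \<union> T) \<le> r * (V - h A)"
proof -
  let ?c = "(real m - 1) / real k"
  define X where "X = Opt - A"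
  have X: "X \<subseteq> N" "finite X" using Opt finite_sub by (auto simp: X_def)
  have "card X \<le> card Opt" unfolding X_def using Opt finite_sub by (intro card_mono) auto
  then have cX: "card X \<le> k" using Opt by simp
  have AN: "A - {a} \<subseteq> N" for a using A by blast
  obtain w1 where w1: "\<forall>x\<in>X. 0 \<le> w1 x" "sum w1 X = marginal f X (A - {a1})"
    "\<forall>S\<subseteq>X. sum w1 S \<le> marginal f S (A - {a1})" using chain_weights[OF AN X(1)] by metis
  obtain w2 where w2: "\<forall>x\<in>X. 0 \<le> w2 x" "sum w2 X = marginal f X (A - {a2})"
    "\<forall>S\<subseteq>X. sum w2 S \<le> marginal f S (A - {a2})" using chain_weights[OF AN X(1)] by metis
  have mk: "1 \<le> m" "m \<le> k" using m k by auto
  obtain S where S: "S \<subseteq> X" "card S \<le> m" "?c * sum w1 X \<le> sum w1 S" "?c * sum w2 X \<le> sum w2 S"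
    using balanced_subset[OF X(2) cX mk, of w1 w2] w1(1) w2(1) by blast
  have "S \<subseteq> N - A" using S(1) Opt(1) by (auto simp: X_def)
  \<comment> \<open>The algorithm adds exactly \<open>m\<close> elements; by monotonicity, padding
    \<open>S\<close> loses nothing.\<close>
  then obtain T where T: "S \<subseteq> T" "T \<subseteq> N - A" "card T = m"
    using exists_subset_between[of S m "N - A"] S(2) room finite_ground by blast
  have main: "V - f (A \<union> T - {a}) \<le> r * (V - h A)"
    if a: "a \<in> {a1, a2}" and g: "?c * marginal f X (A - {a}) \<le> marginal f S (A - {a})" for a
  proof -
    \<comment> \<open>The deleted \<open>a\<close> lies in \<open>A\<close>, hence outside
      \<open>X\<close>, so \<open>Opt - {a}\<close> is covered by
      \<open>A - {a} \<union> X\<close>.\<close>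
    have "V \<le> f (Opt - {a})" using Opt(1) by (rule robust_value_le)
    also have "\<dots> \<le> f (A - {a} \<union> X)" using A a Opt by (intro f_mono) (auto simp: X_def)
    finally have "V - f (A - {a}) \<le> marginal f X (A - {a})" by (simp add: marginal_def)
    then have "?c * (V - f (A - {a})) \<le> ?c * marginal f X (A - {a})"
      using m by (intro mult_left_mono) auto
    also have "\<dots> \<le> f (A - {a} \<union> S) - f (A - {a})" using g by (simp add: marginal_def)
    also have "f (A - {a} \<union> S) \<le> f (A \<union> T - {a})"
      using A a T S by (intro f_mono) (auto simp: X_def)
    finally have "V - f (A \<union> T - {a}) \<le> r * (V - f (A - {a}))" by (simp add: algebra_simps)
    also have "\<dots> \<le> r * (V - h A)"
      using a r_bounds by (intro mult_left_mono) (auto simp: pair_value_def)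
    finally show ?thesis .
  qed
  have "?c * marginal f X (A - {a1}) \<le> marginal f S (A - {a1})"
    using S(1,3) w1 by (metis order_trans)
  moreover have "?c * marginal f X (A - {a2}) \<le> marginal f S (A - {a2})"
    using S(1,4) w2 by (metis order_trans)
  ultimately have "V - h (A \<union> T) \<le> r * (V - h A)"
    using main[of a1] main[of a2] by (auto simp: pair_value_def min_def)
  then show ?thesis using that T by blast
qed

text \<open>
  The bound after the first iteration starts from \<open>2 * D\<close> instead of \<open>0\<close>: an element of
  marginal value \<open>D\<close> over both \<open>a1\<close> and \<open>a2\<close> could have been chosen in that iteration.
\<close>

definition progress :: "'a set \<Rightarrow> nat \<Rightarrow> bool" where
  "progress A i \<longleftrightarrow> card A = 2 + i * m \<and> V - h A \<le> r ^ i * V \<and>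
     (\<forall>D. 1 \<le> i \<longrightarrow> third_element_gain D \<longrightarrow> V - h A \<le> r ^ (i - 1) * (V - 2 * D))"

text \<open>\<open>A'\<close> is the set before the latest iteration: its test succeeded, so its
  robust value is \<open>h A'\<close>, while the current set may have a minimizer outside the pair.
  Progress is claimed only below size \<open>k\<close>, since an iteration reaching \<open>k\<close>
  may have added fewer than \<open>m\<close> elements.\<close>

definition phase1_inv :: "'a set \<Rightarrow> bool" where
  "phase1_inv A \<longleftrightarrow> {a1, a2} \<subseteq> A \<and> A \<subseteq> N \<and> card A \<le> k \<and>
     (card A < k \<longrightarrow> (\<exists>i. progress A i)) \<and>
     (A = {a1, a2} \<or> (\<exists>A' i. {a1, a2} \<subseteq> A' \<and> A' \<subseteq> A \<and> card A \<le> card A' + m \<and>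
        progress A' i \<and> robust_value f 1 A' = h A'))"

lemma card_pair: "card {a1, a2} = 2"
  using a2 by auto

lemma phase1_inv_init: "phase1_inv {a1, a2}"
proof -
  have "0 \<le> h {a1, a2}" unfolding pair_value_def using a1 a2 by (auto intro!: f_nonneg)
  then have "progress {a1, a2} 0" by (auto simp: progress_def card_pair)
  then show ?thesis using a1 a2 card_pair k by (auto simp: phase1_inv_def)
qed

lemma phase1_inv_step:
  assumes inv: "phase1_inv A" and test: "(True, p) \<in> phase1_test k a1 a2 A f"
    and body: "(B, q) \<in> phase1_body N k m a1 a2 A f"
  shows "phase1_inv B"
proof -
  have A: "{a1, a2} \<subseteq> A" "A \<subseteq> N" using inv by (auto simp: phase1_inv_def)
  have finA: "finite A" using A(2) by (rule finite_sub)
  have lt: "card A < k" and mini: "\<And>z. minimizer f A z \<Longrightarrow> z \<in> {a1, a2}"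
    using phase1_testD(1)[OF finA test] by auto
  obtain i where i: "progress A i" using inv lt by (auto simp: phase1_inv_def)
  have "card N \<noteq> 0" using finite_ground a1 by auto
  then have "1 \<le> card N" by simp
  from phase1_bodyD[OF finite_ground this body]
  obtain S where S: "B = A \<union> S" "S \<subseteq> N - A" "card S = min m (k - card A)"
    "\<And>T. T \<subseteq> N - A \<Longrightarrow> card T = min m (k - card A) \<Longrightarrow> h (A \<union> T) \<le> h (A \<union> S)" by metis
  have cB: "card B = card A + card S"
    unfolding S(1) using S(2) finA finite_sub[of S] by (intro card_Un_disjoint) auto
  have B: "{a1, a2} \<subseteq> B" "B \<subseteq> N" using A S by auto
  have "A \<noteq> {}" using A(1) by auto
  then obtain z where z: "minimizer f A z" using ex_minimizer[OF A(2)] by blast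
  have "h A \<le> robust_value f 1 A"
    unfolding minimizer_robust_value[OF A(2) z] pair_value_def using mini[OF z] by auto
  then have robust: "robust_value f 1 A = h A"
    using robust_value_le[OF A(2)] by (intro antisym) (auto simp: pair_value_def)
  have "\<exists>i. progress B i" if "card B < k"
  proof -
    \<comment> \<open>Ending below \<open>k\<close> means that the iteration was not
      truncated.\<close>
    have l: "min m (k - card A) = m" using that cB S(3) by linarith
    have room: "m \<le> card (N - A)" using S(2,3) l finite_ground card_mono[of "N - A" S] by simp
    obtain T where T: "T \<subseteq> N - A" "card T = m" "V - h (A \<union> T) \<le> r * (V - h A)"
      using ex_contracting_set[OF A room] by blast
    have contr: "V - h B \<le> r * (V - h A)" using S(4)[of T] T l unfolding S(1) by simp
    have "card B = 2 + Suc i * m" using cB i S(3) l by (simp add: progress_def)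
    moreover have "V - h B \<le> r ^ Suc i * V"
    proof -
      have "r * (V - h A) \<le> r * (r ^ i * V)"
        using i r_bounds by (intro mult_left_mono) (auto simp: progress_def)
      then show ?thesis using contr by simp
    qed
    moreover have "V - h B \<le> r ^ i * (V - 2 * D)" if D: "third_element_gain D" for D
    proof (cases i)
      \<comment> \<open>In the first iteration a candidate containing the witness \<open>w\<close>
        competes with the chosen set; padded to size \<open>m\<close>, it already gives
        \<open>2 * D\<close>.\<close>
      case 0
      then have "card A = card {a1, a2}" using i card_pair by (simp add: progress_def)
      then have A0: "A = {a1, a2}" using A(1) finA card_subset_eq by metis
      obtain w where w: "w \<in> N - {a1, a2}" "D \<le> marginal f {w} {a1}" "D \<le> marginal f {w} {a2}"
        using D by (auto simp: third_element_gain_def)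
      have "{w} \<subseteq> N - A" using w(1) A0 by auto
      then obtain T where T: "{w} \<subseteq> T" "T \<subseteq> N - A" "card T = m"
        using exists_subset_between[of "{w}" m "N - A"] room m finite_ground by auto
      have "2 * D \<le> h (A \<union> T)" unfolding A0 using T by (intro h_first_step[OF w]) auto
      also have "\<dots> \<le> h B" using S(4)[of T] T l unfolding S(1) by simp
      finally show ?thesis using 0 by simp
    next
      case (Suc j)
      then have "r * (V - h A) \<le> r * (r ^ j * (V - 2 * D))"
        using i r_bounds D by (intro mult_left_mono) (auto simp: progress_def)
      then show ?thesis using contr Suc by simp
    qed
    ultimately have "progress B (Suc i)" by (simp add: progress_def)
    then show ?thesis by blast
  qed
  moreover have "card B \<le> k" "card B \<le> card A + m" using cB S(3) lt by auto
  moreover have "A \<subseteq> B" using S(1) by blast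
  ultimately show ?thesis
    unfolding phase1_inv_def using A B i robust by blast
qed

lemma phase1_result:
  assumes run: "qwhile_run (phase1_test k a1 a2) (phase1_body N k m a1 a2) f {a1, a2} B q"
  obtains A' i where "{a1, a2} \<subseteq> A'" "A' \<subseteq> B" "B \<subseteq> N" "card B \<le> k" "card B \<le> card A' + m"
    "progress A' i" "robust_value f 1 A' = h A'"
    "card B < k \<Longrightarrow> \<exists>z. minimizer f B z \<and> z \<notin> {a1, a2}"
proof -
  have "phase1_inv B \<and> (\<exists>p. (False, p) \<in> phase1_test k a1 a2 B f)"
    by (rule qwhile_run_invariant[where I = phase1_inv, OF run phase1_inv_init])
      (rule phase1_inv_step)
  then obtain p where inv: "phase1_inv B" and p: "(False, p) \<in> phase1_test k a1 a2 B f" by blast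
  have "finite B" using inv finite_sub by (auto simp: phase1_inv_def)
  from phase1_testD(1)[OF this p]
  have stop: "card B < k \<Longrightarrow> \<exists>z. minimizer f B z \<and> z \<notin> {a1, a2}" by blast
  \<comment> \<open>All minimizers of the initial pair lie in the pair and \<open>2 < k\<close>, so
    at least one iteration takes place and \<open>A'\<close> exists.\<close>
  have "B \<noteq> {a1, a2}"
  proof
    assume B: "B = {a1, a2}"
    then have "card B < k" using card_pair k m by simp
    then show False using stop unfolding B minimizer_def by blast
  qed
  then obtain A' i where A': "{a1, a2} \<subseteq> A'" "A' \<subseteq> B" "card B \<le> card A' + m" "progress A' i"
    "robust_value f 1 A' = h A'" using inv unfolding phase1_inv_def by blast
  have "B \<subseteq> N" "card B \<le> k" using inv by (simp_all add: phase1_inv_def)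
  from that[OF A'(1,2) this A'(3-5) stop] show ?thesis by blast
qed

text \<open>The usual averaging over \<open>Opt\<close> applies with \<open>V\<close> as target,
  because \<open>V\<close> is at most \<open>f (A \<union> Opt)\<close>. Elements of
  \<open>Opt\<close> already in \<open>A\<close> have zero marginal, so the greedy choice dominates
  all of \<open>Opt\<close>.\<close>

lemma greedy_step:
  assumes A: "A \<subseteq> N" and x: "x \<in> N - A"
    "\<And>y. y \<in> N - A \<Longrightarrow> marginal f {y} A \<le> marginal f {x} A"
  shows "V - f (A \<union> {x}) \<le> (1 - 1 / real k) * (V - f A)"
proof -
  have k0: "0 < real k" using k by simp
  have mx: "0 \<le> marginal f {x} A" unfolding marginal_def using A x(1) f_mono[of A "A \<union> {x}"] by auto
  have le: "marginal f {y} A \<le> marginal f {x} A" if "y \<in> Opt" for y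
  proof (cases "y \<in> A")
    case True
    then show ?thesis using mx by (simp add: marginal_def insert_absorb)
  next
    case False
    then show ?thesis using x(2) that Opt(1) by blast
  qed
  have "V \<le> f (Opt - {x})" using Opt(1) by (rule robust_value_le)
  also have "\<dots> \<le> f (A \<union> Opt)" using A Opt by (intro f_mono) auto
  finally have "V - f A \<le> marginal f Opt A" by (simp add: marginal_def)
  also have "\<dots> \<le> (\<Sum>y\<in>Opt. marginal f {y} A)" using A Opt(1) by (rule marginal_le_sum)
  also have "\<dots> \<le> real (card Opt) * marginal f {x} A" using le by (rule sum_bounded_above)
  also have "\<dots> \<le> real k * marginal f {x} A" using Opt(2) mx by (intro mult_right_mono) auto
  finally show ?thesis using k0 by (simp add: marginal_def field_simps)
qed

text \<open>The first greedy element \<open>x\<close> is kept apart because its own gain is later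
  compared with \<open>D\<close>; only the remaining \<open>k - card B - 1\<close> steps are used
  for contraction.\<close>

lemma phase2_result:
  assumes run: "qwhile_run (phase2_test k) (phase2_body N) f B A q" and B: "B \<subseteq> N" "card B < k"
  obtains x where "x \<in> N - B" "\<And>y. y \<in> N - B \<Longrightarrow> marginal f {y} B \<le> marginal f {x} B"
    "B \<subseteq> A" "A \<subseteq> N"
    "V - f A \<le> (1 - 1 / real k) ^ (k - card B - 1) * (V - f (B \<union> {x}))"
  using run
proof cases
  case stop
  then show ?thesis using phase2_testD(1)[of False] B by blast
next
  case (step p s' q r')
  from phase2_bodyD[OF finite_ground step(3)]
  obtain x where x: "s' = B \<union> {x}" "x \<in> N - B"
    "\<And>y. y \<in> N - B \<Longrightarrow> marginal f {y} B \<le> marginal f {x} B" by metis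
  \<comment> \<open>The clause \<open>card B + 1 \<le> card s\<close> keeps the natural subtraction
    in the exponent exact.\<close>
  define I where "I s \<longleftrightarrow> B \<subseteq> s \<and> s \<subseteq> N \<and> card B + 1 \<le> card s \<and> card s \<le> k \<and>
    V - f s \<le> (1 - 1 / real k) ^ (card s - card B - 1) * (V - f (B \<union> {x}))" for s
  have cs: "card s' = card B + 1" unfolding x(1) using finite_sub[OF B(1)] x(2) by simp
  have q: "0 \<le> 1 - 1 / real k" using k by simp
  have "I A \<and> (\<exists>p. (False, p) \<in> phase2_test k A f)"
  proof (rule qwhile_run_invariant[OF step(4)])
    show "I s'" using cs x(1,2) B by (auto simp: I_def)
    show "I t" if s: "I s" and t: "(True, p) \<in> phase2_test k s f" and b: "(t, q) \<in> phase2_body N s f"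
      for s t p q
    proof -
      from phase2_bodyD[OF finite_ground b]
      obtain y where y: "t = s \<union> {y}" "y \<in> N - s"
        "\<And>z. z \<in> N - s \<Longrightarrow> marginal f {z} s \<le> marginal f {y} s" by metis
      have lt: "card s < k" using phase2_testD(1)[OF t] by simp
      have sN: "s \<subseteq> N" "B \<subseteq> s" using s by (auto simp: I_def)
      have ct: "card t = card s + 1" unfolding y(1) using finite_sub[OF sN(1)] y(2) by simp
      have "V - f t \<le> (1 - 1 / real k) * (V - f s)" unfolding y(1) using sN(1) y(2,3) by (rule greedy_step)
      also have "\<dots> \<le> (1 - 1 / real k) * ((1 - 1 / real k) ^ (card s - card B - 1) * (V - f (B \<union> {x})))"
        using s q by (intro mult_left_mono) (auto simp: I_def)
      also have "\<dots> = (1 - 1 / real k) ^ Suc (card s - card B - 1) * (V - f (B \<union> {x}))" by simp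
      also have "Suc (card s - card B - 1) = card t - card B - 1"
        using s ct unfolding I_def by linarith
      finally show ?thesis using s ct lt y(1,2) sN unfolding I_def by auto
    qed
  qed
  moreover from this have "\<not> card A < k" using phase2_testD(1)[of False _ k A f] by blast
  ultimately have "I A" "card A = k" by (auto simp: I_def)
  then show ?thesis using that[of x] x(2,3) unfolding I_def by blast
qed

end


section \<open>Estimates for the contraction factors\<close>

lemma exp_minus_one_ge_third: "1 / 3 \<le> exp (- 1 :: real)"
  using exp_le by (simp add: exp_minus field_simps)

text \<open>The inverse of \<open>1 - 1 / k\<close> is \<open>1 + 1 / (k - 1)\<close>, at most
  \<open>exp (1 / (k - 1))\<close>, and at most \<open>k - 1\<close> factors occur; the product is
  therefore at least \<open>exp (- 1)\<close>.\<close>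

lemma power_one_minus_inverse_ge:
  assumes s: "s + 1 \<le> k" and k: "2 \<le> k"
  shows "1 / 3 \<le> (1 - 1 / real k) ^ s"
proof -
  let ?j = "real k - 1"
  have j: "0 < ?j" using k by simp
  have "1 + 1 / ?j \<le> exp (1 / ?j)" by (rule exp_ge_add_one_self)
  then have "exp (- (1 / ?j)) \<le> 1 / (1 + 1 / ?j)"
    using j by (simp add: exp_minus inverse_eq_divide frac_le add_pos_pos)
  also have "1 / (1 + 1 / ?j) = 1 - 1 / real k" using j by (simp add: field_simps)
  finally have "exp (- (1 / ?j)) ^ s \<le> (1 - 1 / real k) ^ s" by (intro power_mono) auto
  moreover have "exp (- 1) \<le> exp (- (1 / ?j)) ^ s"
    using s j by (simp add: exp_of_nat_mult[symmetric] field_simps)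
  ultimately show ?thesis using exp_minus_one_ge_third by linarith
qed

text \<open>Here \<open>s\<close> counts greedy steps and \<open>i\<close> iterations of phase 1.
  Each iteration adds \<open>m\<close> elements but contracts like \<open>m - 1\<close>; this
  deficit \<open>i / k\<close> and the rounding term \<open>1 / k\<close> are each at most
  \<open>1 / m\<close>, which costs a factor \<open>exp (2 / m)\<close>.\<close>

lemma contraction_bound:
  assumes m: "2 \<le> m" and k: "2 * m + 2 \<le> k" and im: "i * m \<le> k" and s: "k \<le> s + i * m + 2 * m + 3"
  shows "(1 - 1 / real k) ^ s * (1 - (real m - 1) / real k) ^ i
    \<le> exp (- ((real k - 2 * real m - 2) / real k)) + 4 / real m"
proof -
  let ?a = "(real k - 2 * real m - 2) / real k"
  have k0: "0 < real k" and m0: "0 < real m" using m k by auto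
  have "1 - 1 / real k \<le> exp (- (1 / real k))" using exp_ge_add_one_self[of "- (1 / real k)"] by simp
  then have "(1 - 1 / real k) ^ s \<le> exp (- (1 / real k)) ^ s" using k by (intro power_mono) auto
  moreover have "1 - (real m - 1) / real k \<le> exp (- ((real m - 1) / real k))"
    using exp_ge_add_one_self[of "- ((real m - 1) / real k)"] by simp
  then have "(1 - (real m - 1) / real k) ^ i \<le> exp (- ((real m - 1) / real k)) ^ i"
    using k by (intro power_mono) (auto simp: divide_le_eq_1)
  ultimately have "(1 - 1 / real k) ^ s * (1 - (real m - 1) / real k) ^ i
    \<le> exp (- (1 / real k)) ^ s * exp (- ((real m - 1) / real k)) ^ i"
    using k by (intro mult_mono) (auto simp: divide_le_eq_1)
  also have "\<dots> = exp (- ((real s + (real m - 1) * real i) / real k))"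
    by (simp add: exp_of_nat_mult[symmetric] exp_add[symmetric] add_divide_distrib
        diff_divide_distrib algebra_simps)
  also have "\<dots> \<le> exp (- ?a + 2 / real m)"
  proof -
    have "real i * real m \<le> real k" using im by (metis of_nat_le_iff of_nat_mult)
    then have i: "real i / real k \<le> 1 / real m" using k0 m0 by (simp add: field_simps)
    have one: "1 / real k \<le> 1 / real m" using k m by (intro divide_left_mono) auto
    have "real k \<le> real (s + i * m + 2 * m + 3)" using s by (simp only: of_nat_le_iff)
    then have "real k - 2 * real m - 2 - real i - 1 \<le> real s + (real m - 1) * real i"
      by (simp add: algebra_simps)
    then have "(real k - 2 * real m - 2 - real i - 1) / real k \<le> (real s + (real m - 1) * real i) / real k"
      using k0 by (intro divide_right_mono) auto
    then have "?a - real i / real k - 1 / real k \<le> (real s + (real m - 1) * real i) / real k"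
      by (simp only: diff_divide_distrib)
    then show ?thesis using i one by simp
  qed
  also have "\<dots> = exp (- ?a) * exp (2 / real m)" by (rule exp_add)
  \<comment> \<open>On the unit interval \<open>exp x \<le> 1 + x + x * x \<le> 1 + 2 * x\<close>,
    used at \<open>x = 2 / m\<close>.\<close>
  also have "\<dots> \<le> exp (- ?a) * (1 + 4 / real m)"
  proof -
    let ?x = "2 / real m"
    have x: "0 \<le> ?x" "?x \<le> 1" using m by auto
    have "?x\<^sup>2 \<le> ?x" unfolding power2_eq_square using x by (intro mult_left_le)
    then have "exp ?x \<le> 1 + 4 / real m" using exp_bound[OF x] by simp
    then show ?thesis by (intro mult_left_mono) auto
  qed
  also have "\<dots> \<le> exp (- ?a) + 4 / real m"
  proof -
    have "0 \<le> ?a" using k by (intro divide_nonneg_nonneg) auto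
    then have "exp (- ?a) * (4 / real m) \<le> 1 * (4 / real m)" by (intro mult_right_mono) auto
    then show ?thesis by (simp add: distrib_left)
  qed
  finally show ?thesis .
qed

section \<open>Combining the two phases\<close>

context robust_comparison
begin

theorem algorithm_quality:
  assumes run1: "qwhile_run (phase1_test k a1 a2) (phase1_body N k m a1 a2) f {a1, a2} B q1"
    and run2: "qwhile_run (phase2_test k) (phase2_body N) f B A q2"
  shows "(1 - (exp (- ((real k - 2 * real m - 2) / real k)) + 4 / real m)) * V \<le> robust_value f 1 A"
proof -
  define E where "E = exp (- ((real k - 2 * real m - 2) / real k)) + 4 / real m"
  from phase1_result[OF run1]
  obtain A' i where A': "{a1, a2} \<subseteq> A'" "A' \<subseteq> B" "progress A' i" "robust_value f 1 A' = h A'"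
    and B: "B \<subseteq> N" "card B \<le> k" "card B \<le> card A' + m"
    and mini: "card B < k \<Longrightarrow> \<exists>z. minimizer f B z \<and> z \<notin> {a1, a2}"
    by metis
  have cA': "card A' = 2 + i * m" using A'(3) by (simp add: progress_def)
  have "card A' \<le> card B" using A'(2) finite_sub[OF B(1)] by (intro card_mono) auto
  then have im: "2 + i * m \<le> k" using cA' B(2) by simp
  have B0: "B \<noteq> {}" using A'(1,2) by auto
  have gB: "h A' \<le> robust_value f 1 B" using robust_value_mono[OF A'(2) B(1) B0] A'(4) by simp
  have "(real k - 2 * real m - 2) / real k \<le> 1" using k by (simp add: divide_le_eq_1)
  then have "exp (- 1) \<le> exp (- ((real k - 2 * real m - 2) / real k))" by simp
  then have E: "1 / 3 \<le> E" unfolding E_def using exp_minus_one_ge_third m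
    by (intro order_trans[OF _ add_increasing2]) auto
  have "(1 - E) * V \<le> robust_value f 1 A"
  proof (cases "card B < k")
    case False
    \<comment> \<open>Phase 1 filled the set, so phase 2 is empty and the contraction bound is used
      with no greedy step.\<close>
    have "A = B" using run2
    proof cases
      case (step p s' q r)
      then show ?thesis using phase2_testD(1)[of True p k B f] False by blast
    qed simp
    have "(1 - 1 / real k) ^ 0 * r ^ i \<le> E"
      unfolding E_def using m k im False B(3) cA' by (intro contraction_bound) auto
    then have "r ^ i * V \<le> E * V" using V_nonneg by (intro mult_right_mono) auto
    moreover have "V - h A' \<le> r ^ i * V" using A'(3) by (simp add: progress_def)
    ultimately show ?thesis using gB unfolding \<open>A = B\<close> by (simp add: left_diff_distrib)
  next
    case lt: True
    then obtain z where z: "minimizer f B z" "z \<notin> {a1, a2}" using mini by blast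
    have gz: "robust_value f 1 B = f (B - {z})" by (rule minimizer_robust_value[OF B(1) z(1)])
    have zB: "z \<in> B" using z(1) by (simp add: minimizer_def)
    let ?q = "(1 - 1 / real k) ^ (k - card B - 1)"
    from phase2_result[OF run2 B(1) lt]
    obtain x where x: "x \<in> N - B" "\<And>y. y \<in> N - B \<Longrightarrow> marginal f {y} B \<le> marginal f {x} B"
      and A: "B \<subseteq> A" "A \<subseteq> N" and fA: "V - f A \<le> ?q * (V - f (B \<union> {x}))"
      by metis
    have A0: "A \<noteq> {}" using A(1) B0 by blast
    obtain y where y: "minimizer f A y" by (rule ex_minimizer[OF A(2) A0])
    have yA: "y \<in> A" using y by (simp add: minimizer_def)
    have gA: "robust_value f 1 A = f (A - {y})" by (rule minimizer_robust_value[OF A(2) y])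
    \<comment> \<open>\<open>\<delta>\<close> and \<open>L\<close> are the losses from the worst
      removal before and after phase 2; \<open>D\<close> bounds both.\<close>
    define \<delta> where "\<delta> = f B - f (B - {z})"
    define L where "L = f A - f (A - {y})"
    define D where "D = max \<delta> L"
    have \<delta>0: "0 \<le> \<delta>" unfolding \<delta>_def using f_mono[of "B - {z}" B] B(1) by auto
    have L: "L = marginal f {y} (A - {y})"
      unfolding L_def marginal_def using yA by (simp add: insert_absorb)
    \<comment> \<open>An element of \<open>B\<close> costs no more to remove from the larger
      \<open>A\<close>, and within \<open>B\<close> the minimizer \<open>z\<close> costs
      most.\<close>
    have small: "L \<le> \<delta>" if "y \<in> B"
    proof -
      have "L \<le> marginal f {y} (B - {y})" unfolding L using A yA by (intro marginal_antimono) auto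
      also have "\<dots> = f B - f (B - {y})" using that by (simp add: marginal_def insert_absorb)
      also have "\<dots> \<le> \<delta>" using robust_value_le[OF B(1), of y] gz by (simp add: \<delta>_def)
      finally show ?thesis .
    qed
    have aB: "{a1, a2} \<subseteq> B" using A' by blast
    have fx: "f B \<le> f (B \<union> {x})" using x(1) B(1) by (intro f_mono) auto
    \<comment> \<open>If \<open>\<delta>\<close> is the larger loss, \<open>z\<close> is the witness
      and \<open>B\<close> itself has the surplus \<open>D\<close>. Otherwise \<open>y\<close> was
      added by phase 2, so it lies outside the pair, and \<open>x\<close> gained at least as much
      over \<open>B\<close> as \<open>y\<close> would have.\<close>
    have D: "third_element_gain D \<and> f (B - {z}) + D \<le> f (B \<union> {x})"
    proof (cases "L \<le> \<delta>")
      case True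
      then have "D = \<delta>" by (simp add: D_def)
      moreover have "third_element_gain \<delta>" unfolding \<delta>_def using aB B(1) zB z(2) by (rule third_element_gainI)
      ultimately show ?thesis using fx by (simp add: \<delta>_def)
    next
      case False
      then have yB: "y \<notin> B" using small by blast
      have DL: "D = L" using False by (simp add: D_def)
      have "third_element_gain L" unfolding L_def using aB A yA yB by (intro third_element_gainI) auto
      moreover have "L \<le> marginal f {y} B" unfolding L using A yA yB by (intro marginal_antimono) auto
      then have "L \<le> marginal f {x} B" using x(2)[of y] yA A yB by force
      then have "f B + L \<le> f (B \<union> {x})" by (simp add: marginal_def)
      ultimately show ?thesis using \<delta>0 DL by (simp add: \<delta>_def)
    qed
    have "2 * D \<le> f {a1, a2}" using D third_element_gain_le(1) by blast
    also have "\<dots> \<le> f (B - {z})" using aB z(2) B(1) by (intro f_mono) auto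
    finally have gB2: "2 * D \<le> f (B - {z})" .
    \<comment> \<open>If \<open>V < 2 * D\<close>, phase 1 alone already exceeds \<open>V\<close>.
      Otherwise \<open>V - 2 * D\<close> is nonnegative, which later allows its coefficient to be
      enlarged to \<open>E\<close>.\<close>
    show ?thesis
    proof (cases "V < 2 * D")
      case True
      have "robust_value f 1 B \<le> robust_value f 1 A" using A A0 by (intro robust_value_mono)
      moreover have "(1 - E) * V \<le> 1 * V" using E V_nonneg by (intro mult_right_mono) auto
      ultimately show ?thesis using True gB2 gz by linarith
    next
      case False
      have D0: "0 \<le> D" using \<delta>0 by (simp add: D_def)
      have q0: "0 \<le> ?q" using k by simp
      have q3: "1 / 3 \<le> ?q" using lt k m by (intro power_one_minus_inverse_ge) auto
      \<comment> \<open>For \<open>i = 0\<close> the truncated exponent is 0, and the claim reduces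
        to \<open>2 * D \<le> f (B - {z})\<close>.\<close>
      have "V - f (B - {z}) \<le> r ^ (i - 1) * (V - 2 * D)"
      proof (cases "1 \<le> i")
        case True
        then have "V - h A' \<le> r ^ (i - 1) * (V - 2 * D)" using A'(3) D by (simp add: progress_def)
        then show ?thesis using gB gz by simp
      next
        case False
        then show ?thesis using gB2 by simp
      qed
      then have "V - f (B \<union> {x}) \<le> r ^ (i - 1) * (V - 2 * D) - D" using D by linarith
      then have "?q * (V - f (B \<union> {x})) \<le> ?q * (r ^ (i - 1) * (V - 2 * D) - D)"
        using q0 by (rule mult_left_mono)
      then have "V - f A \<le> (?q * r ^ (i - 1)) * (V - 2 * D) - ?q * D"
        using fA by (simp add: algebra_simps)
      moreover have "?q * r ^ (i - 1) \<le> E"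
      proof -
        have "(i - 1) * m \<le> k" using im mult_le_mono1[of "i - 1" i m] by linarith
        \<comment> \<open>The slack \<open>2 * m + 3\<close> consists of the first iteration, spent
          on \<open>2 * D\<close>, the iteration after \<open>A'\<close>, the initial pair and the
          first greedy step.\<close>
        moreover have "k \<le> (k - card B - 1) + (i - 1) * m + 2 * m + 3"
          using B(3) cA' lt by (cases i) auto
        ultimately show ?thesis unfolding E_def using m k by (intro contraction_bound)
      qed
      then have "(?q * r ^ (i - 1)) * (V - 2 * D) \<le> E * (V - 2 * D)"
        using False by (intro mult_right_mono) auto
      moreover have "(1 / 3) * D \<le> ?q * D" using q3 D0 by (intro mult_right_mono)
      \<comment> \<open>Subtracting the last removal gives
        \<open>(1 - E) * V + (2 * E + ?q - 1) * D\<close>; the coefficient of \<open>D\<close> is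
        nonnegative since \<open>E\<close> and \<open>?q\<close> are at least
        \<open>1 / 3\<close>.\<close>
      moreover have "f A - D \<le> f (A - {y})" by (simp add: D_def L_def)
      moreover have "(1 / 3) * D \<le> E * D" using E D0 by (intro mult_right_mono)
      ultimately show ?thesis unfolding gA by (simp add: algebra_simps)
    qed
  qed
  then show ?thesis by (simp only: E_def)
qed

end

lemma beta_ratio_zero: "beta_ratio 0 \<alpha> = 1 - exp (- \<alpha>)"
  by (simp add: beta_ratio_def exp_minus field_simps)

theorem theorem11:
  "\<exists>C>0. \<exists>K>0.
     (\<forall>(N :: 'a set) (f :: 'a set \<Rightarrow> real) (k :: nat) (m :: nat).
        finite N \<longrightarrow> mono_on (Pow N) f \<longrightarrow> submodular_on N f \<longrightarrow> f {} = 0 \<longrightarrow> k \<ge> 1 \<longrightarrow> m \<ge> 2 \<longrightarrow>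
        (\<forall>A q. (A, q) \<in> robust_algorithm N k m f \<longrightarrow>
           (\<forall>Opt. is_OPT f k N 1 Opt \<longrightarrow>
              robust_value f 1 A \<ge>
                (beta_ratio 0 ((real k - 2 * real m - 2) / real k) - C / real m)
                  * robust_value f 1 Opt) \<and>
           real q \<le> K * real (card N) ^ (m + 1))) \<and>
     (\<forall>m\<ge>2. (\<lambda>k. beta_ratio 0 ((real k - 2 * real m - 2) / real k) - C / real m)
        \<longlonglongrightarrow> (1 - 1 / exp 1) - C / real m)"
\<comment> \<open>The 4 is the error constant of \<open>contraction_bound\<close>, the 8 that of the
  query count.\<close>
proof (rule exI[of _ 4], intro conjI, simp, rule exI[of _ 8], intro conjI allI impI)
  show "(0::real) < 8" by simp
next
  fix N :: "'a set" and f k m A q Opt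
  assume N: "finite N" and f: "mono_on (Pow N) f" "submodular_on N f" "f {} = 0"
    and k: "k \<ge> 1" and m: "m \<ge> 2"
    and run: "(A, q) \<in> robust_algorithm N k m f" and Opt: "is_OPT f k N 1 Opt"
  interpret monotone_submodular N f using N f by unfold_locales
  let ?a = "(real k - 2 * real m - 2) / real k"
  have A: "A \<subseteq> N" using robust_algorithm_subset_and_cost(1)[OF N m run] .
  have O: "Opt \<subseteq> N" "card Opt \<le> k" using Opt by (auto simp: is_OPT_def is_arg_max_def)
  show "(beta_ratio 0 ?a - 4 / real m) * robust_value f 1 Opt \<le> robust_value f 1 A"
  proof (cases "2 * m + 2 \<le> k")
    case True
    obtain a1 a2 B q1 q2 q3 q4 where
      r1: "(a1, q1) \<in> first_element N f" and r2: "(a2, q2) \<in> greedy_element N {a1} f" and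
      r3: "qwhile_run (phase1_test k a1 a2) (phase1_body N k m a1 a2) f {a1, a2} B q3" and
      r4: "qwhile_run (phase2_test k) (phase2_body N) f B A q4" and
      "q = q1 + (q2 + (q3 + q4))"
      by (rule robust_algorithmD[OF run])
    interpret robust_comparison N f a1 a2 Opt k m
      using first_elementD(1,2)[OF N r1] greedy_elementD(1,2)[OF N r2] O m True
      by unfold_locales
    show ?thesis using algorithm_quality[OF r3 r4] by (simp add: beta_ratio_zero algebra_simps)
  next
    case False
    \<comment> \<open>For small \<open>k\<close> the claimed ratio is not positive, and robust
      values are nonnegative.\<close>
    then have "?a \<le> 0" using k by (simp add: divide_le_0_iff)
    then have "beta_ratio 0 ?a \<le> 0" by (simp add: beta_ratio_zero)
    then have "beta_ratio 0 ?a - 4 / real m \<le> 0" by (smt (verit) divide_nonneg_nonneg of_nat_0_le_iff)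
    then have "(beta_ratio 0 ?a - 4 / real m) * robust_value f 1 Opt \<le> 0"
      using robust_value_nonneg[OF O(1)] by (rule mult_nonpos_nonneg)
    then show ?thesis using robust_value_nonneg[OF A] by linarith
  qed
next
  fix N :: "'a set" and f k m A q
  assume "finite N" "k \<ge> 1" "m \<ge> 2" "(A, q) \<in> robust_algorithm N k m f"
  then have "q \<le> 8 * card N ^ (m + 1)" using robust_algorithm_subset_and_cost(2) by blast
  then have "real q \<le> real (8 * card N ^ (m + 1))" by (simp only: of_nat_le_iff)
  then show "real q \<le> 8 * real (card N) ^ (m + 1)" by simp
next
  fix m :: nat
  have "(\<lambda>k. 1 - (2 * real m + 2) * (1 / real k)) \<longlonglongrightarrow> 1 - (2 * real m + 2) * 0"
    by (intro tendsto_intros lim_1_over_n)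
  \<comment> \<open>The two expressions differ at \<open>k = 0\<close>, where division yields 0, so
    equality is claimed only eventually.\<close>
  moreover have "\<forall>\<^sub>F k in sequentially.
      1 - (2 * real m + 2) * (1 / real k) = (real k - 2 * real m - 2) / real k"
    using eventually_gt_at_top[of 0] by eventually_elim (simp add: field_simps)
  ultimately have "(\<lambda>k. (real k - 2 * real m - 2) / real k) \<longlonglongrightarrow> 1"
    using Lim_transform_eventually by fastforce
  then have "(\<lambda>k. 1 - exp (- ((real k - 2 * real m - 2) / real k)) - 4 / real m)
      \<longlonglongrightarrow> 1 - exp (- 1) - 4 / real m"
    by (intro tendsto_intros)
  then show "(\<lambda>k. beta_ratio 0 ((real k - 2 * real m - 2) / real k) - 4 / real m)
      \<longlonglongrightarrow> 1 - 1 / exp 1 - 4 / real m"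
    by (simp add: beta_ratio_zero exp_minus inverse_eq_divide)
qed

end
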